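(* Let $2\leq k\leq n-1$ and let $G$ be a point lying strictly inside (in the interior of) the hyperbolicity domain $\Pi\subset{\bf R}^n$. Suppose that at $G$ there hold exactly $s$ equalities of the form $x^{(k)}_j=x_i$, with $s$ different indices $j$ and $s$ different indices $i$. Then in a neighbourhood of the point $G$ the discriminant set $D(0,k)$ is locally the union of $s$ smooth hypersurfaces of ${\bf R}^n$ intersecting transversally at $G$.
   Context: A real monic polynomial in one real variable is called hyperbolic (resp. strictly hyperbolic) if all its roots are real (resp. real and distinct). For $a=(a_1,\ldots,a_n)\in{\bf R}^n$ set $P(x,a)=x^n+a_1x^{n-1}+\ldots+a_n$; the hyperbolicity domain is $\Pi=\{a\in{\bf R}^n\mid P(\cdot,a)\text{ is hyperbolic}\}$. Points strictly inside $\Pi$ are those for which $P$ is strictly hyperbolic. For $a\in\Pi$, $x_1\leq\ldots\leq x_n$ denote the roots of $P$ and $x^{(k)}_1\leq\ldots\leq x^{(k)}_{n-k}$ the roots of the $k$-th derivative $P^{(k)}$ (with respect to $x$), which are all real. The discriminant set is $D(i,j)=\{a\in{\bf R}^n\mid {\rm Res}(P^{(i)},P^{(j)})=0\}$, where ${\rm Res}$ is the resultant with respect to $x$ and $P^{(0)}=P$. Smooth hypersurfaces through $G$ intersect transversally at $G$ if their normal vectors (differentials of local defining equations) at $G$ are linearly independent. *)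

theory Defs
  imports "HOL-Analysis.Analysis" "Subresultants.Resultant_Prelim"
begin

no_notation vec_index (infixl "$" 100)

text \<open>
  The space of coefficient vectors is \<open>real ^ 'n\<close>. As the index type carries no order, a labelling
  \<open>e\<close>, used only when it is a bijection from \<open>{1..CARD('n)}\<close> onto \<open>'n\<close>, names the coordinates:
  the coefficient \<open>a\<^sub>i\<close> is \<open>a $ e i\<close>.
\<close>

definition P :: "(nat \<Rightarrow> 'n) \<Rightarrow> real ^ 'n \<Rightarrow> real poly" where
  "P e a = monom 1 CARD('n) + (\<Sum>i = 1..CARD('n). monom (a $ e i) (CARD('n) - i))"

definition dP :: "(nat \<Rightarrow> 'n) \<Rightarrow> nat \<Rightarrow> real ^ 'n \<Rightarrow> real poly" where
  "dP e k a = (pderiv ^^ k) (P e a)"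

definition hyperbolic :: "real poly \<Rightarrow> bool" where
  "hyperbolic p \<longleftrightarrow> (\<forall>z :: complex. poly (map_poly complex_of_real p) z = 0 \<longrightarrow> z \<in> \<real>)"

definition hyperbolicity_domain :: "(nat \<Rightarrow> 'n) \<Rightarrow> (real ^ 'n) set" where
  "hyperbolicity_domain e = {a. hyperbolic (P e a)}"

text \<open>
  The \<open>j\<close>-th real root (counting from \<open>j = 1\<close>) of the \<open>k\<close>-th derivative, the roots being listed in
  nondecreasing order and repeated according to multiplicity. For \<open>a\<close> in the hyperbolicity domain
  and \<open>k \<le> CARD('n)\<close> the list has length \<open>CARD('n) - k\<close>; only indices \<open>j\<close> in
  \<open>{1..CARD('n) - k}\<close> are meaningful.
\<close>

definition ordered_root :: "(nat \<Rightarrow> 'n) \<Rightarrow> nat \<Rightarrow> real ^ 'n \<Rightarrow> nat \<Rightarrow> real" where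
  "ordered_root e k a j = sorted_list_of_multiset (proots (dP e k a)) ! (j - 1)"

definition root_equalities :: "(nat \<Rightarrow> 'n) \<Rightarrow> nat \<Rightarrow> real ^ 'n \<Rightarrow> (nat \<times> nat) set" where
  "root_equalities e k a =
    {(j, i). j \<in> {1..CARD('n) - k} \<and> i \<in> {1..CARD('n)} \<and>
             ordered_root e k a j = ordered_root e 0 a i}"

definition discriminant_set :: "(nat \<Rightarrow> 'n) \<Rightarrow> nat \<Rightarrow> nat \<Rightarrow> (real ^ 'n) set" where
  "discriminant_set e i j = {a. resultant (dP e i a) (dP e j a) = 0}"

text \<open>
  In finite dimension, a function is \<open>C\<^sup>k\<close> on an open set iff it is differentiable there and
  all its directional derivatives are \<open>C\<^sup>k\<^sup>-\<^sup>1\<close>. The predicates are meant for open \<open>U\<close> only.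
\<close>

primrec C_k_on :: "nat \<Rightarrow> 'a::euclidean_space set \<Rightarrow> ('a \<Rightarrow> real) \<Rightarrow> bool" where
  "C_k_on 0 U f \<longleftrightarrow> continuous_on U f"
| "C_k_on (Suc k) U f \<longleftrightarrow>
     (\<forall>x\<in>U. f differentiable (at x)) \<and>
     (\<forall>v. C_k_on k U (\<lambda>x. frechet_derivative f (at x) v))"

definition smooth_on :: "'a::euclidean_space set \<Rightarrow> ('a \<Rightarrow> real) \<Rightarrow> bool" where
  "smooth_on U f \<longleftrightarrow> (\<forall>k. C_k_on k U f)"

text \<open>
  \<open>f\<close> is a regular smooth equation of \<open>M\<close> near the point \<open>p\<close> of \<open>M\<close>, with normal vector
  (gradient) \<open>\<nu>\<close> at \<open>p\<close>.
\<close>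

definition local_equation ::
  "'a::euclidean_space set \<Rightarrow> 'a \<Rightarrow> ('a \<Rightarrow> real) \<Rightarrow> 'a \<Rightarrow> bool" where
  "local_equation M p f \<nu> \<longleftrightarrow>
     p \<in> M \<and> GDERIV f p :> \<nu> \<and> \<nu> \<noteq> 0 \<and>
     (\<exists>V. open V \<and> p \<in> V \<and> smooth_on V f \<and> M \<inter> V = {x \<in> V. f x = 0})"

definition smooth_hypersurface :: "'a::euclidean_space set \<Rightarrow> bool" where
  "smooth_hypersurface M \<longleftrightarrow> (\<forall>p\<in>M. \<exists>f \<nu>. local_equation M p f \<nu>)"

text \<open>
  Linear independence is that of the indexed family of normals, hence the injectivity condition.
  Normals of different local equations at a point are proportional, so it does not matter
  which equations are taken.
\<close>

definition intersect_transversally ::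
  "'i set \<Rightarrow> ('i \<Rightarrow> 'a::euclidean_space set) \<Rightarrow> 'a \<Rightarrow> bool" where
  "intersect_transversally I H p \<longleftrightarrow>
     (\<exists>\<nu>. (\<forall>l\<in>I. \<exists>f. local_equation (H l) p f (\<nu> l)) \<and>
          inj_on \<nu> I \<and> independent (\<nu> ` I))"

end

theory Submission
  imports Defs
    "Subresultants.Subresultant_Gcd"
    "HOL-Computational_Algebra.Field_as_Ring"
    "HOL-Computational_Algebra.Fundamental_Theorem_Algebra"
begin

text \<open>
  The polynomial at an interior point of the hyperbolicity domain has only simple real roots, for
  otherwise adding a small multiple of \<open>1 + (x - r)\<^sup>2\<close> at a multiple root \<open>r\<close> would violate
  Laguerre's inequality \<open>p p'' \<le> p'\<^sup>2\<close>, which all hyperbolic polynomials satisfy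
  (\<open>interior_hyperbolicity_domain_strictly_hyperbolic\<close>).

  By the implicit function theorem each root \<open>r\<close> of the polynomial at \<open>G\<close> continues to a smooth
  function \<open>\<psi>\<^sub>r\<close> of the coefficients. Near \<open>G\<close> these functions stay distinct, hence
  exhaust the complex roots (\<open>roots_follow_coefficients\<close>). The resultant of \<open>P\<close> and its \<open>k\<close>-th
  derivative therefore vanishes exactly where one of the functions
  \<open>F\<^sub>r(a) = P\<^sup>(\<^sup>k\<^sup>)(\<psi>\<^sub>r(a), a)\<close> does, and only the \<open>s\<close> functions with
  \<open>F\<^sub>r(G) = 0\<close> matter close to \<open>G\<close>. Their zero sets are the hypersurfaces.

  What remains is that the differentials of these functions are linearly independent. The direction
  that moves only the root \<open>r\<close> of \<open>P\<close>, with unit speed, is the polynomial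
  \<open>- q\<^sub>r = - P / (x - r)\<close>. Under it, a root \<open>c\<close> of \<open>P\<^sup>(\<^sup>k\<^sup>)\<close>
  moves with speed \<open>T(c, r) = q\<^sub>r\<^sup>(\<^sup>k\<^sup>)(c) / P\<^sup>(\<^sup>k\<^sup>+\<^sup>1\<^sup>)(c)\<close>.
  These speeds are positive (\<open>cofactor_derivative_sign\<close>, again by Laguerre's inequality), and for
  fixed \<open>c\<close> they add up to \<open>1\<close>, because moving all roots together translates everything
  (\<open>sum_cofactors_eq_pderiv\<close>). Up to nonzero row factors, the differentials at the common
  roots, evaluated on the directions \<open>q\<^sub>r\<close> for common roots \<open>r\<close>, form the matrix \<open>T - I\<close>. Not every
  root of \<open>P\<close> is a common one, so the row sums of \<open>T\<close> restricted to common roots are less than \<open>1\<close>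
  and \<open>T - I\<close> is strictly diagonally dominant, hence regular
  (\<open>common_root_functionals_independent\<close>).
\<close>

section \<open>Polynomials with real simple roots\<close>

text \<open>
  Having as many distinct real roots as the degree allows is the form in which real and simple roots
  are counted below; it makes sense for any leading coefficient, as needed for derivatives.
\<close>

definition strictly_hyperbolic :: "real poly \<Rightarrow> bool" where
  "strictly_hyperbolic p \<longleftrightarrow> p \<noteq> 0 \<and> card {x. poly p x = 0} = degree p"

lemma card_roots_le_degree:
  fixes p :: "real poly"
  assumes "p \<noteq> 0"
  shows "card {x. poly p x = 0} \<le> degree p" "finite {x. poly p x = 0}"
  using assms poly_roots_degree poly_roots_finite by blast+

lemma strictly_hyperbolic_if_enough_roots:
  fixes p :: "real poly"
  assumes "p \<noteq> 0" "degree p \<le> card A" "\<And>x. x \<in> A \<Longrightarrow> poly p x = 0"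
  shows "strictly_hyperbolic p"
proof -
  have "card A \<le> card {x. poly p x = 0}"
    using assms(3) by (intro card_mono card_roots_le_degree assms(1)) auto
  then show ?thesis
    using card_roots_le_degree(1)[OF assms(1)] assms by (simp add: strictly_hyperbolic_def)
qed

lemma degree_linear_factor_mult:
  fixes q :: "real poly"
  assumes "q \<noteq> 0"
  shows "degree ([:-r, 1:] * q) = Suc (degree q)"
  by (subst degree_mult_eq) (use assms in auto)

lemma pderiv_linear_factor_mult:
  fixes q :: "real poly"
  shows "pderiv ([:-r, 1:] * q) = q + [:-r, 1:] * pderiv q"
  by (simp add: pderiv_mult pderiv_pCons del: mult_pCons_left)

lemma cofactor_value_at_root:
  fixes p :: "real poly"
  assumes p: "p = [:-r, 1:] * q" and "poly p c = 0"
  shows "poly q c = (if c = r then poly (pderiv p) r else 0)"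
proof -
  have "poly (pderiv p) r = poly q r" unfolding p pderiv_linear_factor_mult by simp
  then show ?thesis using assms(2) by (auto simp: p)
qed

lemma strictly_hyperbolic_simple_root:
  assumes "strictly_hyperbolic p" and "poly p r = 0"
  shows "poly (pderiv p) r \<noteq> 0"
proof
  assume d: "poly (pderiv p) r = 0"
  obtain q where q: "p = [:-r, 1:] * q"
    using assms(2) by (metis dvdE poly_eq_0_iff_dvd)
  have "p \<noteq> 0" and card: "card {x. poly p x = 0} = degree p"
    using assms(1) by (auto simp: strictly_hyperbolic_def)
  then have "q \<noteq> 0" using q by auto
  have "poly q r = 0" using d q by (simp add: pderiv_diff pderiv_smult pderiv_pCons)
  then have "{x. poly p x = 0} = {x. poly q x = 0}" using q by auto
  moreover have "degree p = Suc (degree q)"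
    unfolding q by (rule degree_linear_factor_mult) fact
  ultimately show False
    using card card_roots_le_degree(1)[OF \<open>q \<noteq> 0\<close>] by simp
qed

lemma strictly_hyperbolic_cofactor:
  assumes "strictly_hyperbolic ([:-r, 1:] * q)"
  shows "strictly_hyperbolic q"
proof -
  let ?p = "[:-r, 1:] * q"
  have q0: "q \<noteq> 0" and card: "card {x. poly ?p x = 0} = degree ?p"
    using assms by (auto simp: strictly_hyperbolic_def)
  have "degree ?p = Suc (degree q)"
    using q0 by (rule degree_linear_factor_mult)
  moreover have "{x. poly ?p x = 0} = insert r {x. poly q x = 0}" by auto
  then have "card {x. poly ?p x = 0} \<le> Suc (card {x. poly q x = 0})"
    by (simp add: card_insert_le_m1 card_insert_if card_roots_le_degree(2)[OF q0])
  ultimately have "degree q \<le> card {x. poly q x = 0}" using card by simp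
  then show ?thesis using q0 by (intro strictly_hyperbolic_if_enough_roots) auto
qed

text \<open>
  The induction adds the roots in increasing order. Recording that the critical points found so far
  lie below the largest root makes the new one, located between the two largest roots, a fresh one.
\<close>

lemma rolle_root_count:
  fixes p :: "real poly"
  assumes "finite R" and "R \<noteq> {}" and "\<And>x. x \<in> R \<Longrightarrow> poly p x = 0"
  shows "\<exists>S. finite S \<and> Suc (card S) = card R \<and> (\<forall>x\<in>S. poly (pderiv p) x = 0 \<and> x < Max R)"
  using assms
proof (induction R rule: finite_linorder_max_induct)
  case empty
  then show ?case by simp
next
  case (insert b A)
  show ?case
  proof (cases "A = {}")
    case True
    then show ?thesis by (intro exI[of _ "{}"]) auto
  next
    case False
    then obtain S where S: "finite S" "Suc (card S) = card A"
      "\<And>x. x \<in> S \<Longrightarrow> poly (pderiv p) x = 0" "\<And>x. x \<in> S \<Longrightarrow> x < Max A"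
      using insert by auto
    have "Max A \<in> A" "Max A < b" using False insert by auto
    then have "\<exists>z. Max A < z \<and> z < b \<and> poly (pderiv p) z = 0"
      using poly_MVT[of "Max A" b p] insert.prems by auto
    then obtain z where z: "Max A < z" "z < b" "poly (pderiv p) z = 0" by blast
    have "Max (insert b A) = b"
      using insert.hyps by (intro Max_eqI) (auto intro: less_imp_le)
    moreover have "z \<notin> S" using S(4) z(1) by force
    moreover have "card (insert b A) = Suc (card A)" using insert.hyps by (subst card_insert_disjoint) auto
    moreover have "\<forall>x\<in>insert z S. x < b" using S(4) z by force
    ultimately show ?thesis
      using S z by (intro exI[of _ "insert z S"]) simp
  qed
qed

lemma strictly_hyperbolic_pderiv:
  assumes "strictly_hyperbolic p" and "0 < degree p"
  shows "strictly_hyperbolic (pderiv p)"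
proof -
  have p: "p \<noteq> 0" "card {x. poly p x = 0} = degree p"
    using assms by (auto simp: strictly_hyperbolic_def)
  have "{x. poly p x = 0} \<noteq> {}"
  proof
    assume "{x. poly p x = 0} = {}"
    with p(2) assms(2) show False by (metis card.empty less_not_refl)
  qed
  then have "\<exists>S. finite S \<and> Suc (card S) = card {x. poly p x = 0}
      \<and> (\<forall>x\<in>S. poly (pderiv p) x = 0 \<and> x < Max {x. poly p x = 0})"
    by (intro rolle_root_count card_roots_le_degree(2) p(1)) simp_all
  then obtain S where S: "Suc (card S) = degree p" "\<And>x. x \<in> S \<Longrightarrow> poly (pderiv p) x = 0"
    unfolding p(2) by blast
  have "pderiv p \<noteq> 0" using assms(2) by (simp add: pderiv_eq_0_iff)
  then show ?thesis
    using S by (intro strictly_hyperbolic_if_enough_roots[of _ S]) (auto simp: degree_pderiv)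
qed

lemma strictly_hyperbolic_higher_pderiv:
  assumes "strictly_hyperbolic p" and "k \<le> degree p"
  shows "strictly_hyperbolic ((pderiv ^^ k) p)"
  using assms(2)
proof (induction k)
  case (Suc k)
  then have "0 < degree ((pderiv ^^ k) p)" unfolding degree_higher_pderiv by simp
  then have "strictly_hyperbolic (pderiv ((pderiv ^^ k) p))"
    using Suc by (intro strictly_hyperbolic_pderiv) auto
  then show ?case by simp
qed (simp add: assms)

section \<open>Hyperbolic polynomials and the Laguerre inequality\<close>

lemma hyperbolic_nonzero: "hyperbolic p \<Longrightarrow> p \<noteq> 0"
  using complex_is_Real_iff by (auto simp: hyperbolic_def dest: spec[of _ \<i>])

text \<open>
  The real roots already are as many as a polynomial of this degree can have over the complex numbers.
\<close>

lemma strictly_hyperbolic_imp_hyperbolic: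
  assumes "strictly_hyperbolic p"
  shows "hyperbolic p"
proof -
  let ?pc = "map_poly complex_of_real p"
  have p: "p \<noteq> 0" "card {x. poly p x = 0} = degree p"
    using assms by (auto simp: strictly_hyperbolic_def)
  have pc: "?pc \<noteq> 0" "degree ?pc = degree p" using p by auto
  have "complex_of_real ` {x. poly p x = 0} = {z. poly ?pc z = 0}"
  proof (rule card_seteq)
    show "finite {z. poly ?pc z = 0}" using pc poly_roots_finite by blast
    show "card {z. poly ?pc z = 0} \<le> card (complex_of_real ` {x. poly p x = 0})"
      using poly_roots_degree[OF pc(1)] p(2) pc(2) by (simp add: card_image inj_on_def)
  qed auto
  then have "z \<in> complex_of_real ` {x. poly p x = 0}" if "poly ?pc z = 0" for z
    using that by blast
  then show ?thesis by (fastforce simp: hyperbolic_def)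
qed

lemma hyperbolic_factorE:
  assumes "hyperbolic p" and "0 < degree p"
  obtains r q where "p = [:-r, 1:] * q" "hyperbolic q"
proof -
  let ?pc = "map_poly complex_of_real p"
  have "\<not> constant (poly ?pc)" using assms(2) by (simp add: constant_degree)
  then obtain z where z: "poly ?pc z = 0" using fundamental_theorem_of_algebra by blast
  then obtain r where "z = of_real r" using assms(1) by (auto simp: hyperbolic_def Reals_def)
  then have "poly p r = 0" using z by simp
  then obtain q where q: "p = [:-r, 1:] * q" by (metis dvdE poly_eq_0_iff_dvd)
  interpret map_hom: map_poly_comm_ring_hom complex_of_real ..
  have "hyperbolic q" using assms(1) unfolding hyperbolic_def q map_hom.hom_mult poly_mult by simp
  then show ?thesis using that q by blast
qed

text \<open>
  Splitting off a linear factor, \<open>p = (x - r) q\<close>, gives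
  \<open>p'\<^sup>2 - p p'' = q\<^sup>2 + (x - r)\<^sup>2 (q'\<^sup>2 - q q'')\<close>, so the inequality is inherited from \<open>q\<close>.
\<close>

lemma laguerre_inequality:
  assumes "hyperbolic p"
  shows "poly p x * poly (pderiv (pderiv p)) x \<le> (poly (pderiv p) x)\<^sup>2"
  using assms
proof (induction "degree p" arbitrary: p)
  case 0
  then obtain a where "p = [:a:]" by (metis degree_eq_zeroE)
  then show ?case by (simp add: pderiv_pCons)
next
  case (Suc m)
  then obtain r q where p: "p = [:-r, 1:] * q" and q: "hyperbolic q"
    by (metis hyperbolic_factorE zero_less_Suc)
  have "degree p = Suc (degree q)"
    unfolding p using hyperbolic_nonzero[OF q] by (rule degree_linear_factor_mult)
  with Suc q have IH: "poly q x * poly (pderiv (pderiv q)) x \<le> (poly (pderiv q) x)\<^sup>2" by simp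
  have "(poly (pderiv p) x)\<^sup>2 - poly p x * poly (pderiv (pderiv p)) x
      = (poly q x)\<^sup>2 + (x - r)\<^sup>2 * ((poly (pderiv q) x)\<^sup>2 - poly q x * poly (pderiv (pderiv q)) x)"
    unfolding p pderiv_add pderiv_linear_factor_mult poly_add poly_mult by (simp add: algebra_simps power2_eq_square)
  also have "\<dots> \<ge> 0" using IH by simp
  finally show ?case by simp
qed

lemma hyperbolic_without_double_roots:
  assumes "hyperbolic p" and "\<And>x. poly p x = 0 \<Longrightarrow> poly (pderiv p) x \<noteq> 0"
  shows "strictly_hyperbolic p"
  using assms
proof (induction "degree p" arbitrary: p)
  case 0
  then obtain a where "p = [:a:]" by (metis degree_eq_zeroE)
  then show ?case using hyperbolic_nonzero[OF 0(2)] by (simp add: strictly_hyperbolic_def)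
next
  case (Suc m)
  then obtain r q where p: "p = [:-r, 1:] * q" and q: "hyperbolic q"
    by (metis hyperbolic_factorE zero_less_Suc)
  have q0: "q \<noteq> 0" using q hyperbolic_nonzero by blast
  have deg: "degree p = Suc (degree q)"
    unfolding p using q0 by (rule degree_linear_factor_mult)
  have der: "poly (pderiv p) x = poly q x + (x - r) * poly (pderiv q) x" for x
    unfolding p pderiv_linear_factor_mult by (simp add: algebra_simps)
  have "poly (pderiv q) x \<noteq> 0" if "poly q x = 0" for x
    using Suc.prems(2)[of x] that der[of x] p by auto
  then have "strictly_hyperbolic q" using Suc deg q by simp
  moreover have "poly q r \<noteq> 0" using Suc.prems(2)[of r] der[of r] p by auto
  moreover have "{x. poly p x = 0} = insert r {x. poly q x = 0}" by (auto simp: p)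
  ultimately show ?case
    using deg hyperbolic_nonzero[OF Suc.prems(1)] card_roots_le_degree(2)[OF q0]
    by (simp add: strictly_hyperbolic_def)
qed

section \<open>Resultants and common roots\<close>

lemma resultant_eq_0_iff_common_root:
  assumes "strictly_hyperbolic p"
  shows "resultant p q = 0 \<longleftrightarrow> (\<exists>x. poly p x = 0 \<and> poly q x = 0)"
proof -
  have p0: "p \<noteq> 0" and card: "card {x. poly p x = 0} = degree p"
    using assms by (auto simp: strictly_hyperbolic_def)
  have "resultant p q = 0 \<longleftrightarrow> degree (gcd p q) \<noteq> 0" by (rule resultant_0_gcd)
  also have "\<dots> \<longleftrightarrow> (\<exists>x. poly (gcd p q) x = 0)"
  proof
    \<comment> \<open>If the gcd had no real root, its cofactor would have to carry all roots of \<open>p\<close>, which are too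
      many for its degree.\<close>
    assume deg: "degree (gcd p q) \<noteq> 0"
    show "\<exists>x. poly (gcd p q) x = 0"
    proof (rule ccontr)
      assume no_root: "\<nexists>x. poly (gcd p q) x = 0"
      obtain h where h: "p = gcd p q * h" by (metis dvdE gcd_dvd1)
      have h0: "h \<noteq> 0" "gcd p q \<noteq> 0" using p0 h by auto
      have "{x. poly p x = 0} = {x. poly h x = 0}"
        using no_root by (subst h) auto
      moreover have "degree p = degree (gcd p q) + degree h"
        using degree_mult_eq[OF h0(2,1)] h by simp
      ultimately show False using card deg card_roots_le_degree(1)[OF h0(1)] by simp
    qed
  next
    assume "\<exists>x. poly (gcd p q) x = 0"
    moreover have "gcd p q \<noteq> 0" using p0 by simp
    ultimately show "degree (gcd p q) \<noteq> 0"
      by (metis degree_eq_zeroE poly_const_conv pCons_0_0)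
  qed
  also have "\<dots> \<longleftrightarrow> (\<exists>x. poly p x = 0 \<and> poly q x = 0)"
    by (simp add: poly_eq_0_iff_dvd)
  finally show ?thesis .
qed

section \<open>Independence of the contact functionals\<close>

lemma higher_pderiv_linear_factor_mult:
  fixes q :: "real poly"
  shows "(pderiv ^^ Suc m) ([:-r, 1:] * q)
    = [:-r, 1:] * (pderiv ^^ Suc m) q + Polynomial.smult (real (Suc m)) ((pderiv ^^ m) q)"
proof (induction m)
  case (Suc m)
  let ?B = "(pderiv ^^ Suc m) q"
  have "(pderiv ^^ Suc (Suc m)) ([:-r, 1:] * q)
      = pderiv ([:-r, 1:] * ?B + Polynomial.smult (real (Suc m)) ((pderiv ^^ m) q))"
    using Suc by simp
  also have "\<dots> = ?B + [:-r, 1:] * pderiv ?B + Polynomial.smult (real (Suc m)) ?B"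
    unfolding pderiv_add pderiv_linear_factor_mult pderiv_smult by simp
  also have "\<dots> = [:-r, 1:] * pderiv ?B + Polynomial.smult (1 + real (Suc m)) ?B"
    unfolding smult_add_left by (simp only: smult_1_left add.assoc add.commute add.left_commute)
  finally show ?case by simp
qed (use pderiv_linear_factor_mult[of r q] in simp)

text \<open>
  This says that moving the root \<open>r\<close> of \<open>p\<close> to the right moves every root \<open>c\<close> of the \<open>k\<close>-th
  derivative to the right. With \<open>h = q\<^sup>(\<^sup>k\<^sup>-\<^sup>1\<^sup>)\<close>, the equation \<open>(c - r) h'(c) = - k h(c)\<close>, which expresses
  that \<open>c\<close> is a root of \<open>p\<^sup>(\<^sup>k\<^sup>)\<close>, turns the product into
  \<open>h'\<^sup>2 + k (h'\<^sup>2 - h h'')\<close> at \<open>c\<close>. The second summand is nonnegative by Laguerre's inequality, and \<open>h'(c) = 0\<close> would make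
  \<open>c\<close> a double root of \<open>h\<close>.
\<close>

lemma cofactor_derivative_sign:
  assumes "strictly_hyperbolic p" and p: "p = [:-r, 1:] * q"
    and "1 \<le> k" and "k < degree p" and root: "poly ((pderiv ^^ k) p) c = 0"
  shows "0 < poly ((pderiv ^^ Suc k) p) c * poly ((pderiv ^^ k) q) c"
proof -
  obtain m where k: "k = Suc m" using assms(3) by (cases k) auto
  have q: "strictly_hyperbolic q" using strictly_hyperbolic_cofactor assms(1) p by blast
  have "q \<noteq> 0" using q by (simp add: strictly_hyperbolic_def)
  then have "degree p = Suc (degree q)" unfolding p by (rule degree_linear_factor_mult)
  then have m: "m < degree q" using assms(4) k by simp
  define h where "h = (pderiv ^^ m) q"
  have h: "strictly_hyperbolic h"
    unfolding h_def using strictly_hyperbolic_higher_pderiv[OF q] m by simp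
  have "poly (pderiv h) c \<noteq> 0"
  proof
    assume 0: "poly (pderiv h) c = 0"
    with root have "poly h c = 0"
      unfolding k p higher_pderiv_linear_factor_mult by (simp add: h_def)
    with 0 show False using strictly_hyperbolic_simple_root[OF h] by blast
  qed
  moreover have "poly h c * poly (pderiv (pderiv h)) c \<le> (poly (pderiv h) c)\<^sup>2"
    using laguerre_inequality strictly_hyperbolic_imp_hyperbolic[OF h] by blast
  moreover have "poly ((pderiv ^^ Suc k) p) c * poly ((pderiv ^^ k) q) c
      = (poly (pderiv h) c)\<^sup>2
        + real k * ((poly (pderiv h) c)\<^sup>2 - poly h c * poly (pderiv (pderiv h)) c)"
  proof -
    have eq: "(c - r) * poly (pderiv h) c = - (real k * poly h c)"
      using root unfolding k p higher_pderiv_linear_factor_mult by (simp add: h_def algebra_simps)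
    have d: "poly ((pderiv ^^ Suc k) p) c
        = (c - r) * poly (pderiv (pderiv h)) c + real (Suc k) * poly (pderiv h) c"
      unfolding p higher_pderiv_linear_factor_mult by (simp add: h_def k algebra_simps)
    have "poly ((pderiv ^^ k) q) c = poly (pderiv h) c" by (simp add: h_def k)
    then have "poly ((pderiv ^^ Suc k) p) c * poly ((pderiv ^^ k) q) c
        = (c - r) * poly (pderiv h) c * poly (pderiv (pderiv h)) c
          + real (Suc k) * (poly (pderiv h) c)\<^sup>2"
      unfolding d by (simp add: algebra_simps power2_eq_square)
    then show ?thesis unfolding eq by (simp add: algebra_simps power2_eq_square)
  qed
  ultimately show ?thesis by (simp add: add_pos_nonneg)
qed

text \<open>
  This is the product rule for \<open>p = \<Prod>(x - r)\<close>. It is verified by interpolation: both sides have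
  degree less than \<open>degree p\<close> and agree at the roots of \<open>p\<close>.
\<close>

lemma sum_cofactors_eq_pderiv:
  assumes "strictly_hyperbolic p" and "lead_coeff p = 1" and "0 < degree p"
    and q: "\<And>r. poly p r = 0 \<Longrightarrow> p = [:-r, 1:] * q r"
  shows "(\<Sum>r | poly p r = 0. q r) = pderiv p"
proof -
  let ?R = "{r. poly p r = 0}"
  have p0: "p \<noteq> 0" and card: "card ?R = degree p"
    using assms(1) by (auto simp: strictly_hyperbolic_def)
  have fin: "finite ?R" using card_roots_le_degree(2)[OF p0] .
  have deg: "degree (q r) < degree p" if "poly p r = 0" for r
  proof -
    have "q r \<noteq> 0" using q[OF that] p0 by auto
    from degree_linear_factor_mult[OF this, of r] show ?thesis using q[OF that] by simp
  qed
  have val: "poly (q r) c = (if c = r then poly (pderiv p) r else 0)"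
    if "r \<in> ?R" "c \<in> ?R" for r c
    using cofactor_value_at_root[OF q] that by simp
  show ?thesis
  proof (rule poly_eqI_degree[of ?R])
    fix c assume c: "c \<in> ?R"
    show "poly (\<Sum>r | poly p r = 0. q r) c = poly (pderiv p) c"
    proof -
      have "poly (\<Sum>r | poly p r = 0. q r) c = (\<Sum>r\<in>?R. if c = r then poly (pderiv p) r else 0)"
        unfolding poly_sum using val c by (intro sum.cong) auto
      also have "\<dots> = poly (pderiv p) c" using fin c by (subst sum.delta') auto
      finally show ?thesis .
    qed
  next
    show "degree (\<Sum>r | poly p r = 0. q r) < card ?R"
      unfolding card using deg assms(3) by (intro degree_sum_less) auto
    show "degree (pderiv p) < card ?R" using assms(3) card by (simp add: degree_pderiv)
  qed
qed

text \<open>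
  Taking absolute values and summing the fixed point equations over \<open>r\<close> gives
  \<open>\<Sum>\<bar>v\<^sub>c\<bar> \<le> \<Sum>\<bar>v\<^sub>c\<bar> t\<^sub>c\<close> with row sums \<open>t\<^sub>c < 1\<close>. In other words, \<open>T - I\<close> is regular by
  strict diagonal dominance.
\<close>

lemma substochastic_left_fixed_vector_eq_0:
  fixes T :: "'a \<Rightarrow> 'a \<Rightarrow> real" and v :: "'a \<Rightarrow> real"
  assumes "finite C" and nonneg: "\<And>c r. c \<in> C \<Longrightarrow> r \<in> C \<Longrightarrow> 0 \<le> T c r"
    and rows: "\<And>c. c \<in> C \<Longrightarrow> (\<Sum>r\<in>C. T c r) < 1"
    and fixed: "\<And>r. r \<in> C \<Longrightarrow> v r = (\<Sum>c\<in>C. v c * T c r)"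
    and "c \<in> C"
  shows "v c = 0"
proof -
  have "\<bar>v r\<bar> \<le> (\<Sum>c\<in>C. \<bar>v c\<bar> * T c r)" if "r \<in> C" for r
  proof -
    have "\<bar>v r\<bar> = \<bar>\<Sum>c\<in>C. v c * T c r\<bar>" using fixed[OF that] by simp
    also have "\<dots> \<le> (\<Sum>c\<in>C. \<bar>v c * T c r\<bar>)" by (rule sum_abs)
    finally show ?thesis using nonneg that by (simp add: abs_mult)
  qed
  then have "(\<Sum>r\<in>C. \<bar>v r\<bar>) \<le> (\<Sum>r\<in>C. \<Sum>c\<in>C. \<bar>v c\<bar> * T c r)" by (rule sum_mono)
  also have "\<dots> = (\<Sum>c\<in>C. \<bar>v c\<bar> * (\<Sum>r\<in>C. T c r))"
    by (subst sum.swap) (simp add: sum_distrib_left)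
  finally have "(\<Sum>c\<in>C. \<bar>v c\<bar> * (1 - (\<Sum>r\<in>C. T c r))) \<le> 0"
    by (simp add: algebra_simps sum_subtractf)
  moreover have pos: "0 \<le> \<bar>v c\<bar> * (1 - (\<Sum>r\<in>C. T c r))" if "c \<in> C" for c
    using rows[OF that] by (intro mult_nonneg_nonneg) auto
  ultimately have "(\<Sum>c\<in>C. \<bar>v c\<bar> * (1 - (\<Sum>r\<in>C. T c r))) = 0"
    by (meson order_antisym sum_nonneg)
  then have "\<bar>v c\<bar> * (1 - (\<Sum>r\<in>C. T c r)) = 0"
    using sum_nonneg_eq_0_iff[OF assms(1) pos] \<open>c \<in> C\<close> by simp
  then show ?thesis using rows[OF \<open>c \<in> C\<close>] by auto
qed

text \<open>
  The functional attached to a common root \<open>c\<close> is the differential, at \<open>p\<close>, of the value that the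
  \<open>k\<close>-th derivative takes at the root \<open>c\<close> as this root follows the polynomial. Testing the relation on
  the cofactors \<open>p / (x - r)\<close> of the common roots \<open>r\<close> gives a left fixed vector of a matrix with
  positive entries and row sums less than \<open>1\<close>.
\<close>

lemma common_root_functionals_independent:
  assumes hyp: "strictly_hyperbolic p" and monic: "lead_coeff p = 1"
    and k: "1 \<le> k" "k < degree p"
    and C: "C \<subseteq> {c. poly p c = 0 \<and> poly ((pderiv ^^ k) p) c = 0}"
    and vanish: "\<And>q. degree q < degree p \<Longrightarrow>
      (\<Sum>c\<in>C. \<mu> c * (poly ((pderiv ^^ k) q) c
        - poly ((pderiv ^^ Suc k) p) c / poly (pderiv p) c * poly q c)) = 0"
    and "c \<in> C"
  shows "\<mu> c = 0"
proof -
  let ?R = "{r. poly p r = 0}" and ?f = "(pderiv ^^ k) p"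
  let ?D = "\<lambda>c. poly ((pderiv ^^ Suc k) p) c"
  have p0: "p \<noteq> 0" and card: "card ?R = degree p"
    using hyp by (auto simp: strictly_hyperbolic_def)
  have fin: "finite ?R" using card_roots_le_degree(2)[OF p0] .
  have f: "strictly_hyperbolic ?f" using strictly_hyperbolic_higher_pderiv[OF hyp] k by simp
  have CR: "C \<subseteq> ?R" using C by auto
  then have finC: "finite C" using fin finite_subset by blast
  have "card C \<le> card {x. poly ?f x = 0}"
    using C f by (intro card_mono card_roots_le_degree(2)) (auto simp: strictly_hyperbolic_def)
  also have "\<dots> = degree p - k" using f by (simp add: strictly_hyperbolic_def degree_higher_pderiv)
  also have "\<dots> < card ?R" using k card by simp
  \<comment> \<open>the derivative has too few roots for all roots of \<open>p\<close> to be common\<close>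
  finally have C_ne: "C \<noteq> ?R" by auto
  have D: "?D c \<noteq> 0" if "c \<in> C" for c
    using strictly_hyperbolic_simple_root[OF f, of c] that C by auto
  define q where "q r = (SOME q. p = [:-r, 1:] * q)" for r
  have q: "p = [:-r, 1:] * q r" if "r \<in> ?R" for r
    unfolding q_def by (rule someI_ex) (use that in \<open>auto simp: poly_eq_0_iff_dvd dvd_def\<close>)
  have q_deg: "degree (q r) < degree p" if "r \<in> ?R" for r
  proof -
    have "q r \<noteq> 0" using q[OF that] p0 by auto
    from degree_linear_factor_mult[OF this, of r] show ?thesis using q[OF that] by simp
  qed
  have q_val: "poly (q r) c = (if c = r then poly (pderiv p) c else 0)"
    if "r \<in> ?R" "c \<in> ?R" for r c
    using cofactor_value_at_root[OF q] that by simp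
  define T where "T c r = poly ((pderiv ^^ k) (q r)) c / ?D c" for c r
  have T_pos: "0 < T c r" if "c \<in> C" "r \<in> ?R" for c r
  proof -
    have "poly ?f c = 0" using that C by auto
    then have "0 < ?D c * poly ((pderiv ^^ k) (q r)) c"
      using cofactor_derivative_sign[OF hyp q[OF that(2)] k] by blast
    then show ?thesis unfolding T_def zero_less_mult_iff zero_less_divide_iff by blast
  qed
  have T_sum: "(\<Sum>r\<in>?R. T c r) = 1" if "c \<in> C" for c
  proof -
    have "(\<Sum>r\<in>?R. T c r) = poly ((pderiv ^^ k) (\<Sum>r\<in>?R. q r)) c / ?D c"
      by (simp add: T_def higher_pderiv_sum poly_sum sum_divide_distrib)
    also have "(\<Sum>r\<in>?R. q r) = pderiv p"
      using sum_cofactors_eq_pderiv[OF hyp monic, of q] q k by simp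
    finally show ?thesis using D[OF that] by (simp add: funpow_swap1)
  qed
  have "\<mu> c * ?D c = 0"
  proof (rule substochastic_left_fixed_vector_eq_0[where T = T and C = C and v = "\<lambda>c. \<mu> c * ?D c"])
    fix c assume c: "c \<in> C"
    obtain r where r: "r \<in> ?R" "r \<notin> C" using C_ne CR by auto
    have "(\<Sum>r\<in>C. T c r) < (\<Sum>r\<in>?R. T c r)"
      using T_pos[OF c] CR r by (intro sum_strict_mono2 fin) (auto intro: less_imp_le)
    then show "(\<Sum>r\<in>C. T c r) < 1" using T_sum[OF c] by simp
  next
    fix r assume r: "r \<in> C"
    then have rR: "r \<in> ?R" using CR by auto
    have "0 = (\<Sum>c\<in>C. \<mu> c * (poly ((pderiv ^^ k) (q r)) c
        - ?D c / poly (pderiv p) c * poly (q r) c))"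
      using vanish[OF q_deg[OF rR]] by simp
    also have "\<dots> = (\<Sum>c\<in>C. \<mu> c * ?D c * T c r - (if c = r then \<mu> r * ?D r else 0))"
    proof (intro sum.cong refl)
      fix c assume c: "c \<in> C"
      then have "poly p c = 0" using C by auto
      then have "poly (pderiv p) c \<noteq> 0" using strictly_hyperbolic_simple_root[OF hyp] by blast
      moreover have "poly ((pderiv ^^ k) (q r)) c = ?D c * T c r"
        using D[OF c] by (simp add: T_def)
      moreover have "poly (q r) c = (if c = r then poly (pderiv p) c else 0)"
        using q_val[OF rR] c CR by blast
      ultimately show "\<mu> c * (poly ((pderiv ^^ k) (q r)) c - ?D c / poly (pderiv p) c * poly (q r) c)
          = \<mu> c * ?D c * T c r - (if c = r then \<mu> r * ?D r else 0)"
        by (cases "c = r") (simp_all add: algebra_simps)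
    qed
    also have "\<dots> = (\<Sum>c\<in>C. \<mu> c * ?D c * T c r) - \<mu> r * ?D r"
      using finC r by (simp add: sum_subtractf)
    finally show "\<mu> r * ?D r = (\<Sum>c\<in>C. \<mu> c * ?D c * T c r)" by simp
  qed (use finC T_pos CR \<open>c \<in> C\<close> in \<open>auto intro: less_imp_le\<close>)
  then show ?thesis using D[OF \<open>c \<in> C\<close>] by simp
qed

section \<open>The space of coefficient vectors\<close>

text \<open>
  The linear part of the affine map \<open>P e\<close>. When \<open>e\<close> names all coordinates, it identifies the
  directions in the space of coefficient vectors with the polynomials of degree less than \<open>CARD('n)\<close>.
\<close>

definition increment :: "(nat \<Rightarrow> 'n) \<Rightarrow> real ^ 'n \<Rightarrow> real poly" where
  "increment e v = (\<Sum>i = 1..CARD('n). monom (v $ e i) (CARD('n) - i))"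

lemma P_add: "P e (a + v) = P e a + increment e v"
  by (simp add: P_def increment_def sum.distrib flip: add_monom)

lemma increment_scaleR: "increment e (c *\<^sub>R v) = Polynomial.smult c (increment e v)"
  by (simp add: increment_def smult_sum2 smult_monom)

lemma degree_increment: "degree (increment e (v :: real ^ 'n)) < CARD('n)"
  unfolding increment_def
  by (intro degree_sum_less) (auto intro: le_less_trans[OF degree_monom_le])

lemma degree_P: "degree (P e (a :: real ^ 'n)) = CARD('n)"
  and lead_coeff_P: "lead_coeff (P e a) = 1"
proof -
  have P: "P e a = increment e a + monom 1 CARD('n)" by (simp add: P_def increment_def)
  show deg: "degree (P e a) = CARD('n)"
    unfolding P using degree_increment[of e a]
    by (subst degree_add_eq_right) (auto simp: degree_monom_eq)
  show "lead_coeff (P e a) = 1"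
    unfolding deg unfolding P using degree_increment[of e a] by (simp add: coeff_eq_0)
qed

lemma increment_surj:
  fixes e :: "nat \<Rightarrow> 'n::finite"
  assumes e: "bij_betw e {1..CARD('n)} UNIV" and "degree q < CARD('n)"
  shows "\<exists>v. increment e v = q"
proof -
  define v :: "real ^ 'n" where
    "v = (\<chi> j. coeff q (CARD('n) - inv_into {1..CARD('n)} e j))"
  have v: "v $ e i = coeff q (CARD('n) - i)" if "i \<in> {1..CARD('n)}" for i
    using that bij_betw_inv_into_left[OF e that] by (simp add: v_def)
  have "increment e v = (\<Sum>i = 1..CARD('n). monom (coeff q (CARD('n) - i)) (CARD('n) - i))"
    unfolding increment_def using v by simp
  also have "\<dots> = (\<Sum>m<CARD('n). monom (coeff q m) m)"
    by (rule sum.reindex_bij_witness[where i = "\<lambda>m. CARD('n) - m" and j = "\<lambda>i. CARD('n) - i"]) auto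
  also have "\<dots> = q" by (rule poly_as_sum_of_monoms'[where n = "CARD('n) - 1", folded lessThan_Suc_atMost, simplified]) (use assms(2) in auto)
  finally show ?thesis by blast
qed

text \<open>
  At a multiple root \<open>r\<close>, adding \<open>t (1 + (x - r)\<^sup>2)\<close> keeps the first derivative at \<open>r\<close> zero while the
  value becomes \<open>t\<close> and the second derivative changes by \<open>2 t\<close>. If the sign of \<open>t\<close> agrees with that of
  the second derivative, Laguerre's inequality fails, so no neighbourhood consists of hyperbolic
  polynomials. The perturbation needs the coefficients of \<open>1\<close>, \<open>x\<close> and \<open>x\<^sup>2\<close>, whence the bound on the
  dimension.
\<close>

lemma interior_hyperbolicity_domain_strictly_hyperbolic:
  fixes e :: "nat \<Rightarrow> 'n::finite"
  assumes e: "bij_betw e {1..CARD('n)} UNIV" and card: "3 \<le> CARD('n)"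
    and G: "G \<in> interior (hyperbolicity_domain e)"
  shows "strictly_hyperbolic (P e G)"
proof (rule hyperbolic_without_double_roots)
  have hyp: "hyperbolic (P e G)" using G interior_subset by (auto simp: hyperbolicity_domain_def)
  then show "hyperbolic (P e G)" .
  fix r assume r: "poly (P e G) r = 0"
  show "poly (pderiv (P e G)) r \<noteq> 0"
  proof
    assume r': "poly (pderiv (P e G)) r = 0"
    \<comment> \<open>the polynomial \<open>1 + (x - r)\<^sup>2\<close>\<close>
    define w where "w = [:1 + r\<^sup>2, - 2 * r, 1:]"
    then have "degree w < CARD('n)" using card by simp
    then obtain v where v: "increment e v = w" using increment_surj[OF e] by blast
    obtain d where d: "0 < d" "ball G d \<subseteq> hyperbolicity_domain e"
      using G by (meson mem_interior)
    define N where "N = norm v + 1"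
    define t0 where "t0 = d / (2 * N)"
    have t0: "0 < t0" "t0 * norm v < d"
    proof -
      have n1: "0 < N" by (simp add: N_def add_nonneg_pos)
      then show "0 < t0" using d(1) by (simp add: t0_def)
      have "t0 * norm v \<le> t0 * N" using \<open>0 < t0\<close> by (simp add: N_def)
      also have "\<dots> = d / 2" using n1 by (simp add: t0_def)
      finally show "t0 * norm v < d" using d(1) by simp
    qed
    define t where "t = (if 0 \<le> poly (pderiv (pderiv (P e G))) r then t0 else - t0)"
    have "G + t *\<^sub>R v \<in> ball G d"
      using t0 by (auto simp: t_def dist_norm)
    then have "hyperbolic (P e (G + t *\<^sub>R v))" using d by (auto simp: hyperbolicity_domain_def)
    moreover have "P e (G + t *\<^sub>R v) = P e G + Polynomial.smult t w"
      by (simp add: P_add increment_scaleR v)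
    ultimately have "hyperbolic (P e G + Polynomial.smult t w)" by simp
    from laguerre_inequality[OF this, of r]
    have "t * (poly (pderiv (pderiv (P e G))) r + t * 2) \<le> 0"
      using r r' unfolding w_def
      by (simp add: pderiv_add pderiv_smult pderiv_pCons algebra_simps power2_eq_square)
    then show False using t0(1)
      by (auto simp: t_def mult_le_0_iff split: if_splits)
  qed
qed

lemma dP_eq: "dP e j a = (pderiv ^^ j) (monom 1 CARD('n))
    + (\<Sum>i = 1..CARD('n). Polynomial.smult (a $ e i) ((pderiv ^^ j) (monom 1 (CARD('n) - i))))"
  for a :: "real ^ 'n"
  by (simp add: dP_def P_def higher_pderiv_add higher_pderiv_sum smult_monom
      flip: higher_pderiv_smult)

lemma increment_higher_pderiv: "(pderiv ^^ j) (increment e v)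
    = (\<Sum>i = 1..CARD('n). Polynomial.smult (v $ e i) ((pderiv ^^ j) (monom 1 (CARD('n) - i))))"
  for v :: "real ^ 'n"
  by (simp add: increment_def higher_pderiv_sum smult_monom flip: higher_pderiv_smult)

text \<open>
  Coefficients and argument both vary with \<open>z\<close>, which covers the evaluation map on pairs as well as
  the evaluation along a moving root.
\<close>

lemma poly_dP_has_derivative:
  fixes \<alpha> :: "'b::real_normed_vector \<Rightarrow> real ^ 'n"
  assumes "(\<alpha> has_derivative \<alpha>') (at z)" and "(\<psi> has_derivative \<psi>') (at z)"
  shows "((\<lambda>z. poly (dP e j (\<alpha> z)) (\<psi> z)) has_derivative
    (\<lambda>h. poly ((pderiv ^^ j) (increment e (\<alpha>' h))) (\<psi> z) + \<psi>' h * poly (dP e (Suc j) (\<alpha> z)) (\<psi> z))) (at z)"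
proof -
  have [derivative_intros]:
    "((\<lambda>z. poly q (\<psi> z)) has_derivative (\<lambda>h. \<psi>' h * poly (pderiv q) (\<psi> z))) (at z)" for q
  proof -
    have "(poly q has_derivative (\<lambda>t. t * poly (pderiv q) (\<psi> z))) (at (\<psi> z))"
      by (rule has_derivative_eq_rhs[OF poly_DERIV[unfolded has_field_derivative_def]])
        (simp add: fun_eq_iff)
    from has_derivative_compose[OF assms(2) this] show ?thesis .
  qed
  have [derivative_intros]: "((\<lambda>z. \<alpha> z $ i) has_derivative (\<lambda>h. \<alpha>' h $ i)) (at z)" for i
    using bounded_linear.has_derivative[OF bounded_linear_vec_nth assms(1)] .
  have Suc: "dP e (Suc j) a = pderiv (dP e j a)" for a :: "real ^ 'n" by (simp add: dP_def)
  show ?thesis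
    unfolding Suc dP_eq increment_higher_pderiv poly_add poly_sum poly_smult
    by (auto intro!: derivative_eq_intros simp: fun_eq_iff pderiv_add pderiv_sum pderiv_smult
        poly_sum sum.distrib sum_distrib_left algebra_simps)
qed

section \<open>Smoothness via algebras closed under differentiation\<close>

lemma C_k_on_cong:
  assumes "open U" and "\<And>x. x \<in> U \<Longrightarrow> f x = g x" and "C_k_on k U f"
  shows "C_k_on k U g"
  using assms(2,3)
proof (induction k arbitrary: f g)
  case 0
  then show ?case using continuous_on_cong[of U U f g] by simp
next
  case (Suc k)
  have transfer: "(g has_derivative D) (at x)" if "(f has_derivative D) (at x)" "x \<in> U" for D x
    using has_derivative_transform_within_open[OF that(1) assms(1) that(2)] Suc.prems(1) by simp
  have der: "(f has_derivative frechet_derivative f (at x)) (at x)" if "x \<in> U" for x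
    using Suc.prems(2) that by (simp add: frechet_derivative_works)
  have "g differentiable (at x)" if "x \<in> U" for x
    using transfer[OF der] that by (auto simp: differentiable_def)
  moreover have frechet_eq: "frechet_derivative f (at x) = frechet_derivative g (at x)" if "x \<in> U" for x
    using frechet_derivative_at[OF transfer[OF der]] that by simp
  have "C_k_on k U (\<lambda>x. frechet_derivative g (at x) v)" for v
  proof (rule Suc.IH)
    show "C_k_on k U (\<lambda>x. frechet_derivative f (at x) v)" using Suc.prems(2) by simp
  qed (simp add: frechet_eq)
  ultimately show ?case by simp
qed

text \<open>
  A root \<open>\<psi>\<close> of \<open>P\<close> has a derivative which is a polynomial expression in \<open>\<psi>\<close>, the coefficients and the
  reciprocal \<open>w\<close> of \<open>P'(\<psi>)\<close>; the same is true of \<open>w\<close>. All higher derivatives are then available at once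
  from the algebra generated by \<open>\<psi>\<close>, \<open>w\<close> and the coordinates.
\<close>

inductive_set function_algebra :: "('a \<Rightarrow> real) set \<Rightarrow> ('a \<Rightarrow> real) set"
  for B :: "('a \<Rightarrow> real) set" where
  generator: "f \<in> B \<Longrightarrow> f \<in> function_algebra B"
| const: "(\<lambda>_. c) \<in> function_algebra B"
| add: "f \<in> function_algebra B \<Longrightarrow> g \<in> function_algebra B \<Longrightarrow> (\<lambda>x. f x + g x) \<in> function_algebra B"
| mult: "f \<in> function_algebra B \<Longrightarrow> g \<in> function_algebra B \<Longrightarrow> (\<lambda>x. f x * g x) \<in> function_algebra B"

lemma function_algebra_sum:
  assumes "\<And>i. i \<in> I \<Longrightarrow> f i \<in> function_algebra B"
  shows "(\<lambda>x. \<Sum>i\<in>I. f i x) \<in> function_algebra B"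
  using assms
  by (induction I rule: infinite_finite_induct) (auto intro: function_algebra.intros)

lemma function_algebra_uminus:
  "f \<in> function_algebra B \<Longrightarrow> (\<lambda>x. - f x) \<in> function_algebra B"
  using function_algebra.mult[OF function_algebra.const[of "-1"]] by force

lemma function_algebra_poly:
  assumes "f \<in> function_algebra B"
  shows "(\<lambda>x. poly q (f x)) \<in> function_algebra B"
  by (induction q) (auto intro!: function_algebra.add function_algebra.mult function_algebra.const assms)

text \<open>
  It is enough to differentiate the generators inside the algebra: by the sum and product rules the
  whole algebra is then closed under directional derivatives, and induction on the order of
  differentiability applies to all its members simultaneously.
\<close>

lemma function_algebra_smooth_on:
  fixes B :: "('a::euclidean_space \<Rightarrow> real) set"
  assumes "open U"
    and gen: "\<And>f. f \<in> B \<Longrightarrow> \<exists>D. (\<forall>x\<in>U. (f has_derivative D x) (at x))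
      \<and> (\<forall>v. (\<lambda>x. D x v) \<in> function_algebra B)"
    and "f \<in> function_algebra B"
  shows "smooth_on U f"
proof -
  have der: "\<exists>D. (\<forall>x\<in>U. (f has_derivative D x) (at x)) \<and> (\<forall>v. (\<lambda>x. D x v) \<in> function_algebra B)"
    if "f \<in> function_algebra B" for f
    using that
  proof induction
    case (const c)
    show ?case by (rule exI[of _ "\<lambda>_ _. 0"]) (auto intro: function_algebra.const)
  next
    case (add f g)
    then obtain D E where "\<forall>x\<in>U. (f has_derivative D x) (at x)" "\<forall>v. (\<lambda>x. D x v) \<in> function_algebra B"
      "\<forall>x\<in>U. (g has_derivative E x) (at x)" "\<forall>v. (\<lambda>x. E x v) \<in> function_algebra B" by blast
    then show ?case
      by (intro exI[of _ "\<lambda>x v. D x v + E x v"]) (auto intro: function_algebra.add has_derivative_add)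
  next
    case (mult f g)
    then obtain D E where "\<forall>x\<in>U. (f has_derivative D x) (at x)" "\<forall>v. (\<lambda>x. D x v) \<in> function_algebra B"
      "\<forall>x\<in>U. (g has_derivative E x) (at x)" "\<forall>v. (\<lambda>x. E x v) \<in> function_algebra B" by blast
    with mult show ?case
      by (intro exI[of _ "\<lambda>x v. f x * E x v + D x v * g x"])
        (auto intro!: function_algebra.add function_algebra.mult has_derivative_mult)
  qed (rule gen)
  have "C_k_on k U f" if "f \<in> function_algebra B" for k f
    using that
  proof (induction k arbitrary: f)
    case 0
    then obtain D where "\<forall>x\<in>U. (f has_derivative D x) (at x)" using der by blast
    then show ?case
      by (auto intro!: continuous_at_imp_continuous_on has_derivative_continuous)
  next
    case (Suc k)
    then obtain D where D: "\<And>x. x \<in> U \<Longrightarrow> (f has_derivative D x) (at x)"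
      "\<And>v. (\<lambda>x. D x v) \<in> function_algebra B" using der by blast
    have "C_k_on k U (\<lambda>x. frechet_derivative f (at x) v)" for v
      using frechet_derivative_at[OF D(1)]
      by (intro C_k_on_cong[OF \<open>open U\<close> _ Suc.IH[OF D(2)[of v]]]) simp
    then show ?case using D(1) by (auto simp: differentiable_def)
  qed
  then show ?thesis using assms(3) by (simp add: smooth_on_def)
qed

section \<open>Continuation of simple roots\<close>

text \<open>
  The map \<open>(a, x) \<mapsto> (a, F(a, x))\<close> is injective on a product of an open set and an interval, by Rolle's
  theorem, and its image is open by invariance of domain. The inverse map is differentiable by the
  inverse function theorem, and \<open>\<psi>(a)\<close> is the second component of the preimage of \<open>(a, 0)\<close>.
\<close>

lemma scalar_implicit_function:
  fixes F :: "'a::euclidean_space \<times> real \<Rightarrow> real"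
  assumes "open W" and "(a0, x0) \<in> W" and "F (a0, x0) = 0"
    and F': "\<And>z. z \<in> W \<Longrightarrow> (F has_derivative F' z) (at z)"
    and nz: "\<And>z. z \<in> W \<Longrightarrow> F' z (0, 1) \<noteq> 0"
  obtains U \<psi> where "open U" "a0 \<in> U" "\<psi> a0 = x0"
    "\<And>a. a \<in> U \<Longrightarrow> (a, \<psi> a) \<in> W" "\<And>a. a \<in> U \<Longrightarrow> F (a, \<psi> a) = 0"
    "\<And>a. a \<in> U \<Longrightarrow> \<psi> differentiable (at a)"
proof -
  obtain A X where box: "open A" "open X" "(a0, x0) \<in> A \<times> X" "A \<times> X \<subseteq> W"
    using open_prod_elim[OF assms(1,2)] by blast
  obtain \<delta> where \<delta>: "0 < \<delta>" "ball x0 \<delta> \<subseteq> X" using box by (meson openE mem_Sigma_iff)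
  \<comment> \<open>the fibres of \<open>S\<close> over \<open>A\<close> must be intervals for Rolle's theorem\<close>
  define S where "S = A \<times> ball x0 \<delta>"
  have S: "open S" "S \<subseteq> W" "(a0, x0) \<in> S" using box \<delta> by (auto simp: S_def intro: open_Times)
  define \<Phi> where "\<Phi> z = (fst z, F z)" for z
  define \<Phi>' where "\<Phi>' z h = (fst h, F' z h)" for z h
  have \<Phi>': "(\<Phi> has_derivative \<Phi>' z) (at z)" if "z \<in> S" for z
    unfolding \<Phi>_def \<Phi>'_def using F'[OF subsetD[OF S(2) that]] by (intro derivative_intros)
  then have cont: "continuous_on S \<Phi>"
    by (auto intro!: continuous_at_imp_continuous_on has_derivative_continuous)
  have inj: "inj_on \<Phi> S"
  proof -
    have False if "(a, x) \<in> S" "(a, y) \<in> S" "F (a, x) = F (a, y)" "x < y" for a x y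
    proof -
      have seg: "(a, t) \<in> S" if "t \<in> {x..y}" for t
        using \<open>(a, x) \<in> S\<close> \<open>(a, y) \<in> S\<close> that
        by (auto simp: S_def dist_real_def)
      have der: "((\<lambda>t. F (a, t)) has_derivative (\<lambda>h. F' (a, t) (0, h))) (at t)" if "t \<in> {x..y}" for t
      proof -
        have "((\<lambda>t. (a, t)) has_derivative (\<lambda>h. (0, h))) (at t)" by (auto intro!: derivative_intros)
        from has_derivative_compose[OF this F'] show ?thesis using seg[OF that] S by auto
      qed
      have "continuous_on {x..y} (\<lambda>t. F (a, t))"
        using der by (intro continuous_at_imp_continuous_on ballI has_derivative_continuous) auto
      then have "\<exists>t>x. t < y \<and> (\<lambda>h. F' (a, t) (0, h)) = (\<lambda>_. 0)"
        using der by (intro Rolle_deriv[where f = "\<lambda>t. F (a, t)"] \<open>x < y\<close> that(3)) auto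
      then obtain t where "t \<in> {x..y}" "(\<lambda>h. F' (a, t) (0, h)) = (\<lambda>_. 0)"
        by (meson atLeastAtMost_iff less_imp_le)
      then show False using nz[of "(a, t)"] seg S by (metis subsetD)
    qed
    then show ?thesis
      unfolding inj_on_def \<Phi>_def by (metis linorder_neqE prod.collapse fst_conv snd_conv)
  qed
  define g where "g = inv_into S \<Phi>"
  have g: "g (\<Phi> z) = z" if "z \<in> S" for z using inj that by (simp add: g_def)
  have "open (\<Phi> ` S)" using invariance_of_domain[OF cont S(1) inj] .
  define U where "U = (\<lambda>a. (a, 0 :: real)) -` (\<Phi> ` S)"
  have "open U" unfolding U_def
    using \<open>open (\<Phi> ` S)\<close> by (intro open_vimage) (auto intro!: continuous_intros)
  define \<psi> where "\<psi> a = snd (g (a, 0))" for a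
  have pt: "(a, \<psi> a) \<in> S \<and> \<Phi> (a, \<psi> a) = (a, 0)" if "a \<in> U" for a
  proof -
    have "(a, 0) \<in> \<Phi> ` S" using that by (simp add: U_def)
    then obtain z where z: "z \<in> S" "\<Phi> z = (a, 0)" by (metis imageE)
    then have "g (a, 0) = z" using g[OF z(1)] by simp
    moreover have "fst z = a" using z by (simp add: \<Phi>_def)
    ultimately have "z = (a, \<psi> a)" by (simp add: \<psi>_def prod_eq_iff)
    then show ?thesis using z by simp
  qed
  have "\<psi> differentiable (at a)" if "a \<in> U" for a
  proof -
    let ?z = "(a, \<psi> a)"
    have z: "?z \<in> S" "\<Phi> ?z = (a, 0)" using pt[OF that] by auto
    interpret F': bounded_linear "F' ?z" using F' z S by (meson has_derivative_bounded_linear subsetD)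
    let ?d = "F' ?z (0, 1)"
    have d: "?d \<noteq> 0" using nz z S by blast
    have split: "F' ?z (v, t) = F' ?z (v, 0) + t * ?d" for v t
      using F'.add[of "(v, 0)" "(0, t)"] F'.scaleR[of t "(0, 1)"] by simp
    \<comment> \<open>the differential of \<open>\<Phi>\<close> is triangular with diagonal entries identity and \<open>?d\<close>\<close>
    have "\<Phi>' ?z \<circ> (\<lambda>(v, w). (v, (w - F' ?z (v, 0)) / ?d)) = id"
    proof (rule ext)
      fix h :: "'a \<times> real"
      obtain v w where h: "h = (v, w)" by fastforce
      show "(\<Phi>' ?z \<circ> (\<lambda>(v, w). (v, (w - F' ?z (v, 0)) / ?d))) h = id h"
        using d split[of v "(w - F' ?z (v, 0)) / ?d"] by (simp add: h \<Phi>'_def)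
    qed
    from has_derivative_inverse_strong[OF S(1) z(1) cont g \<Phi>'[OF z(1)] this]
    have "g differentiable (at (a, 0))" using z(2) by (auto simp: differentiable_def)
    moreover have "(\<lambda>a. (a, 0 :: real)) differentiable (at a)" by (auto simp: differentiable_def intro!: derivative_intros exI)
    ultimately have "(g \<circ> (\<lambda>a. (a, 0))) differentiable (at a)" by (rule differentiable_chain_at[rotated])
    then have "(snd \<circ> (g \<circ> (\<lambda>a. (a, 0)))) differentiable (at a)"
      by (rule differentiable_chain_at) (rule bounded_linear_imp_differentiable[OF bounded_linear_snd])
    then show ?thesis by (simp add: \<psi>_def[abs_def] o_def)
  qed
  moreover have "a0 \<in> U" "\<psi> a0 = x0"
  proof -
    have "\<Phi> (a0, x0) = (a0, 0)" using assms(3) by (simp add: \<Phi>_def)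
    then show "a0 \<in> U" using S(3) by (force simp: U_def)
    show "\<psi> a0 = x0" using g[OF S(3)] \<open>\<Phi> (a0, x0) = (a0, 0)\<close> by (simp add: \<psi>_def)
  qed
  ultimately show ?thesis
    using that[of U \<psi>] \<open>open U\<close> pt S(2) by (auto simp: \<Phi>_def)
qed

lemma increment_0: "increment e 0 = 0"
  by (simp add: increment_def)

text \<open>
  The existence of \<open>\<psi>\<close> is the implicit function theorem for \<open>(a, x) \<mapsto> P(x, a)\<close>; the formula for its
  derivative then comes from differentiating \<open>P(\<psi>(a), a) = 0\<close>.
\<close>

lemma simple_root_continuation:
  fixes G :: "real ^ 'n"
  assumes root: "poly (P e G) r = 0" and simple: "poly (pderiv (P e G)) r \<noteq> 0"
  obtains U \<psi> where "open U" "G \<in> U" "\<psi> G = r"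
    "\<And>a. a \<in> U \<Longrightarrow> poly (P e a) (\<psi> a) = 0"
    "\<And>a. a \<in> U \<Longrightarrow> poly (pderiv (P e a)) (\<psi> a) \<noteq> 0"
    "\<And>a. a \<in> U \<Longrightarrow>
      (\<psi> has_derivative (\<lambda>v. - poly (increment e v) (\<psi> a) / poly (pderiv (P e a)) (\<psi> a))) (at a)"
proof -
  define E where "E j z = poly (dP e j (fst z)) (snd z)" for j and z :: "(real ^ 'n) \<times> real"
  define E' where "E' j z h = poly ((pderiv ^^ j) (increment e (fst h))) (snd z) + snd h * E (Suc j) z"
    for j and z h :: "(real ^ 'n) \<times> real"
  have E': "(E j has_derivative E' j z) (at z)" for j z
    unfolding E_def E'_def
    by (rule poly_dP_has_derivative)
      (rule bounded_linear_imp_has_derivative[OF bounded_linear_fst]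
        bounded_linear_imp_has_derivative[OF bounded_linear_snd])+
  have E0: "E 0 (a, x) = poly (P e a) x" and E1: "E (Suc 0) (a, x) = poly (pderiv (P e a)) x" for a x
    by (simp_all add: E_def dP_def)
  define W where "W = {z. E (Suc 0) z \<noteq> 0}"
  have "continuous_on UNIV (E (Suc 0))"
    by (intro continuous_at_imp_continuous_on ballI has_derivative_continuous[OF E'])
  then have "open W" unfolding W_def by (intro open_Collect_neq continuous_intros)
  moreover have "(G, r) \<in> W" using simple by (simp add: W_def E1)
  moreover have "E 0 (G, r) = 0" using root by (simp add: E0)
  moreover have "(E 0 has_derivative E' 0 z) (at z)" for z by (rule E')
  moreover have "E' 0 z (0, 1) \<noteq> 0" if "z \<in> W" for z
    using that by (simp add: E'_def W_def increment_0)
  ultimately obtain U \<psi> where U: "open U" "G \<in> U" "\<psi> G = r"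
    "\<And>a. a \<in> U \<Longrightarrow> (a, \<psi> a) \<in> W" "\<And>a. a \<in> U \<Longrightarrow> E 0 (a, \<psi> a) = 0"
    "\<And>a. a \<in> U \<Longrightarrow> \<psi> differentiable (at a)"
    by (rule scalar_implicit_function[of W G r "E 0" "E' 0"]) blast+
  have "(\<psi> has_derivative (\<lambda>v. - poly (increment e v) (\<psi> a) / poly (pderiv (P e a)) (\<psi> a))) (at a)"
    if a: "a \<in> U" for a
  proof -
    obtain \<psi>' where \<psi>': "(\<psi> has_derivative \<psi>') (at a)"
      using U(6)[OF a] by (auto simp: differentiable_def)
    have "((\<lambda>a. poly (dP e 0 a) (\<psi> a)) has_derivative (\<lambda>v. poly ((pderiv ^^ 0) (increment e v)) (\<psi> a)
        + \<psi>' v * poly (dP e (Suc 0) a) (\<psi> a))) (at a)"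
      by (rule poly_dP_has_derivative[OF has_derivative_ident \<psi>'])
    moreover have "((\<lambda>a. poly (dP e 0 a) (\<psi> a)) has_derivative (\<lambda>v. 0)) (at a)"
    proof (rule has_derivative_transform_within_open[OF _ U(1) a])
      show "((\<lambda>_. 0) has_derivative (\<lambda>v. 0)) (at a)" by simp
      show "0 = poly (dP e 0 a) (\<psi> a)" if "a \<in> U" for a using U(5)[OF that] by (simp add: E_def)
    qed
    ultimately have "(\<lambda>v. poly ((pderiv ^^ 0) (increment e v)) (\<psi> a)
        + \<psi>' v * poly (dP e (Suc 0) a) (\<psi> a)) = (\<lambda>v. 0)"
      by (rule has_derivative_unique)
    from fun_cong[OF this]
    have eq: "poly (increment e v) (\<psi> a) + \<psi>' v * poly (pderiv (P e a)) (\<psi> a) = 0" for v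
      by (simp add: dP_def)
    have "poly (pderiv (P e a)) (\<psi> a) \<noteq> 0" using U(4)[OF that] by (simp add: W_def E1)
    then have "\<psi>' v = - poly (increment e v) (\<psi> a) / poly (pderiv (P e a)) (\<psi> a)" for v
      using eq[of v] by (simp add: field_simps eq_neg_iff_add_eq_0)
    then show ?thesis using \<psi>' by presburger
  qed
  moreover have "poly (pderiv (P e a)) (\<psi> a) \<noteq> 0" if "a \<in> U" for a
    using U(4)[OF that] by (simp add: W_def E1)
  moreover have "poly (P e a) (\<psi> a) = 0" if "a \<in> U" for a
    using U(5)[OF that] by (simp add: E0)
  ultimately show ?thesis using that U(1-3) by blast
qed

lemma root_function_smooth:
  fixes \<psi> :: "real ^ 'n \<Rightarrow> real"
  assumes "open U"
    and simple: "\<And>a. a \<in> U \<Longrightarrow> poly (pderiv (P e a)) (\<psi> a) \<noteq> 0"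
    and \<psi>': "\<And>a. a \<in> U \<Longrightarrow>
      (\<psi> has_derivative (\<lambda>v. - poly (increment e v) (\<psi> a) / poly (pderiv (P e a)) (\<psi> a))) (at a)"
  shows "smooth_on U (\<lambda>a. poly (dP e k a) (\<psi> a))"
proof -
  define w where "w a = inverse (poly (dP e 1 a) (\<psi> a))" for a
  define B where "B = insert \<psi> (insert w (range (\<lambda>i (a :: real ^ 'n). a $ i)))"
  have \<psi>B: "\<psi> \<in> function_algebra B" and wB: "w \<in> function_algebra B"
    and coordB: "(\<lambda>a. a $ i) \<in> function_algebra B" for i
    by (rule function_algebra.generator; simp add: B_def)+
  have dPB: "(\<lambda>a. poly (dP e j a) (\<psi> a)) \<in> function_algebra B" for j
    unfolding dP_eq poly_add poly_sum poly_smult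
    by (intro function_algebra.add function_algebra_sum function_algebra.mult
        function_algebra_poly \<psi>B coordB)
  \<comment> \<open>the derivative of \<open>\<psi>\<close>, written without division so that it lies in the algebra\<close>
  define D where "D a v = - poly (increment e v) (\<psi> a) * w a" for a v
  have DB: "(\<lambda>a. D a v) \<in> function_algebra B" for v
    unfolding D_def
    by (intro function_algebra.mult function_algebra_uminus function_algebra_poly \<psi>B wB)
  have D: "(\<psi> has_derivative D a) (at a)" if "a \<in> U" for a
    using \<psi>'[OF that] by (simp add: D_def[abs_def] w_def dP_def divide_inverse)
  show ?thesis
  proof (rule function_algebra_smooth_on[OF assms(1) _ dPB[of k]])
    fix f assume "f \<in> B"
    then consider "f = \<psi>" | "f = w" | i where "f = (\<lambda>a. a $ i)" by (auto simp: B_def)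
    then show "\<exists>D. (\<forall>x\<in>U. (f has_derivative D x) (at x)) \<and> (\<forall>v. (\<lambda>x. D x v) \<in> function_algebra B)"
    proof cases
      case 1
      then show ?thesis using D DB by blast
    next
      case 2
      let ?Q = "\<lambda>a v. poly ((pderiv ^^ 1) (increment e v)) (\<psi> a) + D a v * poly (dP e (Suc 1) a) (\<psi> a)"
      have "(w has_derivative (\<lambda>v. - (w a * ?Q a v * w a))) (at a)" if "a \<in> U" for a
      proof -
        have der: "((\<lambda>a. poly (dP e 1 a) (\<psi> a)) has_derivative ?Q a) (at a)"
          by (rule poly_dP_has_derivative[OF has_derivative_ident D[OF that]])
        have nz: "poly (dP e 1 a) (\<psi> a) \<noteq> 0" using simple[OF that] by (simp add: dP_def)
        from Deriv.has_derivative_inverse[OF nz der] show ?thesis unfolding w_def[abs_def] .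
      qed
      moreover have "(\<lambda>a. - (w a * ?Q a v * w a)) \<in> function_algebra B" for v
        by (intro function_algebra.add function_algebra.mult function_algebra_uminus
            function_algebra_poly \<psi>B wB DB dPB)
      ultimately show ?thesis
        using 2 by (intro exI[of _ "\<lambda>a v. - (w a * ?Q a v * w a)"]) blast
    next
      case 3
      then show ?thesis
        by (intro exI[of _ "\<lambda>a v. v $ i"])
          (auto intro!: function_algebra.const bounded_linear_imp_has_derivative bounded_linear_vec_nth)
    qed
  qed
qed

section \<open>Normal vectors and ordered roots\<close>

lemma independent_family:
  fixes \<nu> :: "'i \<Rightarrow> 'a::real_vector"
  assumes "finite I" and "\<And>\<mu> i. (\<Sum>i\<in>I. \<mu> i *\<^sub>R \<nu> i) = 0 \<Longrightarrow> i \<in> I \<Longrightarrow> \<mu> i = 0"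
  shows "inj_on \<nu> I" and "independent (\<nu> ` I)"
proof -
  show inj: "inj_on \<nu> I"
  proof (rule inj_onI, rule ccontr)
    fix i j assume ij: "i \<in> I" "j \<in> I" "\<nu> i = \<nu> j" "i \<noteq> j"
    define \<mu> :: "'i \<Rightarrow> real" where "\<mu> l = (if l = i then 1 else if l = j then - 1 else 0)" for l
    have "(\<Sum>l\<in>I. \<mu> l *\<^sub>R \<nu> l) = (\<Sum>l\<in>{i, j}. \<mu> l *\<^sub>R \<nu> l)"
      using assms(1) ij by (intro sum.mono_neutral_right) (auto simp: \<mu>_def)
    also have "\<dots> = 0" using ij by (simp add: \<mu>_def)
    finally have "\<mu> i = 0" using assms(2) ij(1) by blast
    then show False by (simp add: \<mu>_def)
  qed
  show "independent (\<nu> ` I)"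
  proof
    assume "dependent (\<nu> ` I)"
    then obtain u i where "i \<in> I" "u (\<nu> i) \<noteq> 0" "(\<Sum>v\<in>\<nu> ` I. u v *\<^sub>R v) = 0"
      unfolding dependent_finite[OF finite_imageI[OF assms(1)]] by blast
    then show False
      using assms(2)[of "\<lambda>i. u (\<nu> i)" i] by (simp add: sum.reindex[OF inj])
  qed
qed

lemma gradient_of_derivative:
  fixes f :: "'a::euclidean_space \<Rightarrow> real"
  assumes "(f has_derivative f') (at x)"
  shows "\<exists>\<nu>. GDERIV f x :> \<nu> \<and> (\<forall>v. v \<bullet> \<nu> = f' v)"
proof -
  interpret f': bounded_linear f' using assms has_derivative_bounded_linear by blast
  have "v \<bullet> (\<Sum>b\<in>Basis. f' b *\<^sub>R b) = f' v" for v
  proof -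
    have "f' v = f' (\<Sum>b\<in>Basis. (v \<bullet> b) *\<^sub>R b)" by (simp add: euclidean_representation)
    also have "\<dots> = (\<Sum>b\<in>Basis. (v \<bullet> b) * f' b)" by (simp add: f'.sum f'.scaleR)
    finally show ?thesis by (simp add: inner_sum_right mult.commute)
  qed
  then show ?thesis
    using assms by (intro exI[of _ "\<Sum>b\<in>Basis. f' b *\<^sub>R b"]) (simp add: gderiv_def)
qed

lemma sorted_roots_list:
  assumes "strictly_hyperbolic p"
  defines "L \<equiv> sorted_list_of_multiset (proots p)"
  shows "distinct L" "set L = {x. poly p x = 0}" "length L = degree p"
proof -
  have p: "p \<noteq> 0" "card {x. poly p x = 0} = degree p"
    using assms(1) by (auto simp: strictly_hyperbolic_def)
  show set: "set L = {x. poly p x = 0}" using p(1) by (simp add: L_def)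
  have len: "length L = size (proots p)" unfolding L_def by (metis size_mset mset_sorted_list_of_multiset)
  then have "length L \<le> card (set L)" using size_proots_le[of p] p(2) set by simp
  then show "distinct L" by (meson card_distinct card_length order_antisym)
  then show "length L = degree p" using distinct_card set p(2) by metis
qed

text \<open>
  Since both polynomials have simple roots, a pair \<open>(j, i)\<close> is determined by the common root at which
  the equality takes place.
\<close>

lemma card_root_equalities:
  fixes G :: "real ^ 'n"
  assumes hyp: "strictly_hyperbolic (P e G)" and k: "k \<le> CARD('n)"
  shows "card (root_equalities e k G) = card {x. poly (P e G) x = 0 \<and> poly (dP e k G) x = 0}"
proof -
  define L where "L j = sorted_list_of_multiset (proots (dP e j G))" for j
  have L: "distinct (L j)" "set (L j) = {x. poly (dP e j G) x = 0}" "length (L j) = CARD('n) - j"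
    if "j \<le> CARD('n)" for j
  proof -
    have "strictly_hyperbolic (dP e j G)"
      unfolding dP_def using strictly_hyperbolic_higher_pderiv[OF hyp] that by (simp add: degree_P)
    note sorted_roots_list[OF this, folded L_def]
    then show "distinct (L j)" "set (L j) = {x. poly (dP e j G) x = 0}" "length (L j) = CARD('n) - j"
      by (simp_all add: dP_def degree_higher_pderiv degree_P)
  qed
  let ?C = "{x. poly (P e G) x = 0 \<and> poly (dP e k G) x = 0}"
  have C: "?C = set (L k) \<inter> set (L 0)" using L[OF k] L[of 0] by (auto simp: dP_def)
  have eqs: "root_equalities e k G = {(j, i). j \<in> {1..length (L k)} \<and> i \<in> {1..length (L 0)}
      \<and> L k ! (j - 1) = L 0 ! (i - 1)}"
    using L(3)[OF k] L(3)[of 0] by (simp add: root_equalities_def ordered_root_def L_def)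
  have "bij_betw (\<lambda>(j, i). L k ! (j - 1)) (root_equalities e k G) ?C"
    unfolding bij_betw_def
  proof
    have index_eq: "j = j'" if "l \<le> CARD('n)" "j \<in> {1..length (L l)}" "j' \<in> {1..length (L l)}"
      "L l ! (j - 1) = L l ! (j' - 1)" for l j j'
    proof -
      have "j - 1 < length (L l)" "j' - 1 < length (L l)" using that(2,3) by auto
      then have "j - 1 = j' - 1"
        using nth_eq_iff_index_eq[OF L(1)[OF that(1)]] that(4) by blast
      then show ?thesis using that(2,3) unfolding atLeastAtMost_iff by linarith
    qed
    show "inj_on (\<lambda>(j, i). L k ! (j - 1)) (root_equalities e k G)"
    proof (rule inj_onI)
      fix u u' assume u: "u \<in> root_equalities e k G" "u' \<in> root_equalities e k G"
        "(case u of (j, i) \<Rightarrow> L k ! (j - 1)) = (case u' of (j, i) \<Rightarrow> L k ! (j - 1))"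
      obtain j i j' i' where ji: "u = (j, i)" "u' = (j', i')" by (meson surj_pair)
      have "j = j'" using u unfolding ji eqs by (intro index_eq[OF k]) simp_all
      moreover have "i = i'" using u unfolding ji eqs by (intro index_eq[of 0]) simp_all
      ultimately show "u = u'" by (simp add: ji)
    qed
    show "(\<lambda>(j, i). L k ! (j - 1)) ` root_equalities e k G = ?C"
    proof (intro equalityI subsetI)
      fix x assume "x \<in> (\<lambda>(j, i). L k ! (j - 1)) ` root_equalities e k G"
      then obtain j i where ji: "j \<in> {1..length (L k)}" "i \<in> {1..length (L 0)}"
        "L k ! (j - 1) = x" "L 0 ! (i - 1) = x"
        unfolding eqs by auto
      have "x \<in> set (L k)" unfolding ji(3)[symmetric] using ji(1) by (intro nth_mem) auto
      moreover have "x \<in> set (L 0)" unfolding ji(4)[symmetric] using ji(2) by (intro nth_mem) auto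
      ultimately show "x \<in> ?C" unfolding C by blast
    next
      fix x assume "x \<in> ?C"
      then obtain j i where "j < length (L k)" "L k ! j = x" "i < length (L 0)" "L 0 ! i = x"
        unfolding C by (auto simp: in_set_conv_nth)
      then show "x \<in> (\<lambda>(j, i). L k ! (j - 1)) ` root_equalities e k G"
        unfolding eqs by (intro image_eqI[of _ _ "(Suc j, Suc i)"]) auto
    qed
  qed
  then show ?thesis by (rule bij_betw_same_card)
qed

section \<open>The discriminant set near a strictly hyperbolic polynomial\<close>

text \<open>
  The differential at \<open>a\<close>, in direction \<open>v\<close>, of the value of the \<open>k\<close>-th derivative at the root \<open>c\<close>
  of \<open>P e a\<close>, where the root moves along; the second term is the contribution of this motion.
\<close>

definition contact_differential :: "(nat \<Rightarrow> 'n) \<Rightarrow> nat \<Rightarrow> real ^ 'n \<Rightarrow> real \<Rightarrow> real ^ 'n \<Rightarrow> real" where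
  "contact_differential e k a c v = poly ((pderiv ^^ k) (increment e v)) c
    - poly (dP e (Suc k) a) c / poly (pderiv (P e a)) c * poly (increment e v) c"

text \<open>
  Every polynomial of degree less than \<open>CARD('n)\<close> is the increment in some direction, so a relation
  between the differentials is one between the functionals on polynomials.
\<close>

lemma contact_differentials_independent:
  fixes e :: "nat \<Rightarrow> 'n::finite"
  assumes e: "bij_betw e {1..CARD('n)} UNIV" and hyp: "strictly_hyperbolic (P e a)"
    and k: "1 \<le> k" "k < CARD('n)"
    and C: "C \<subseteq> {c. poly (P e a) c = 0 \<and> poly (dP e k a) c = 0}"
    and vanish: "\<And>v. (\<Sum>c\<in>C. \<mu> c * contact_differential e k a c v) = 0"
    and "c \<in> C"
  shows "\<mu> c = 0"
proof (rule common_root_functionals_independent[OF hyp lead_coeff_P k(1) _ _ _ \<open>c \<in> C\<close>])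
  show "k < degree (P e a)" using k by (simp add: degree_P)
  show "C \<subseteq> {c. poly (P e a) c = 0 \<and> poly ((pderiv ^^ k) (P e a)) c = 0}"
    using C by (simp add: dP_def)
  fix q :: "real poly" assume "degree q < degree (P e a)"
  then obtain v where "increment e v = q" using increment_surj[OF e] by (auto simp: degree_P)
  then show "(\<Sum>c\<in>C. \<mu> c * (poly ((pderiv ^^ k) q) c
      - poly ((pderiv ^^ Suc k) (P e a)) c / poly (pderiv (P e a)) c * poly q c)) = 0"
    using vanish[of v] by (simp only: contact_differential_def dP_def)
qed

text \<open>
  Near \<open>G\<close> the continuations of the distinct roots have distinct values by continuity. These are
  \<open>CARD('n)\<close> real roots, so there are no others.
\<close>

lemma roots_follow_coefficients:
  fixes G :: "real ^ 'n"
  assumes hyp: "strictly_hyperbolic (P e G)"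
  obtains U \<psi> where "open U" "G \<in> U"
    "\<And>r. poly (P e G) r = 0 \<Longrightarrow> \<psi> r G = r"
    "\<And>a. a \<in> U \<Longrightarrow> strictly_hyperbolic (P e a)"
    "\<And>a. a \<in> U \<Longrightarrow> {x. poly (P e a) x = 0} = (\<lambda>r. \<psi> r a) ` {r. poly (P e G) r = 0}"
    "\<And>r a. poly (P e G) r = 0 \<Longrightarrow> a \<in> U \<Longrightarrow> (\<psi> r has_derivative
      (\<lambda>v. - poly (increment e v) (\<psi> r a) / poly (pderiv (P e a)) (\<psi> r a))) (at a)"
proof -
  let ?R = "{r. poly (P e G) r = 0}"
  have G0: "P e G \<noteq> 0" and card: "card ?R = CARD('n)"
    using hyp by (auto simp: strictly_hyperbolic_def degree_P)
  have fin: "finite ?R" using card_roots_le_degree(2)[OF G0] .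
  define Q where "Q r V \<psi> \<longleftrightarrow> open V \<and> G \<in> V \<and> \<psi> G = r \<and> (\<forall>a\<in>V. poly (P e a) (\<psi> a) = 0 \<and>
      (\<psi> has_derivative (\<lambda>v. - poly (increment e v) (\<psi> a) / poly (pderiv (P e a)) (\<psi> a))) (at a))"
    for r V \<psi>
  have "\<exists>V \<psi>. Q r V \<psi>" if "r \<in> ?R" for r
  proof -
    have r: "poly (P e G) r = 0" using that by simp
    show ?thesis
      by (rule simple_root_continuation[OF r strictly_hyperbolic_simple_root[OF hyp r]])
        (unfold Q_def, blast)
  qed
  then obtain V \<psi> where Q: "\<And>r. r \<in> ?R \<Longrightarrow> Q r (V r) (\<psi> r)" by metis
  have V: "open (V r)" "G \<in> V r" if "r \<in> ?R" for r
    using Q[OF that] unfolding Q_def by blast+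
  have \<psi>: "\<psi> r G = r"
      "\<And>a. a \<in> V r \<Longrightarrow> poly (P e a) (\<psi> r a) = 0"
      "\<And>a. a \<in> V r \<Longrightarrow> (\<psi> r has_derivative
        (\<lambda>v. - poly (increment e v) (\<psi> r a) / poly (pderiv (P e a)) (\<psi> r a))) (at a)"
    if "r \<in> ?R" for r
    using Q[OF that] unfolding Q_def by blast+
  have lim: "(\<psi> r \<longlongrightarrow> r) (nhds G)" if "r \<in> ?R" for r
    using has_derivative_continuous[OF \<psi>(3)[OF that V(2)[OF that]]] \<psi>(1)[OF that]
      tendsto_at_iff_tendsto_nhds[of "\<psi> r" G] by (simp add: isCont_def)
  have near: "\<forall>\<^sub>F a in nhds G. a \<in> V r" if "r \<in> ?R" for r
    using V that by (auto intro: eventually_nhds_in_open)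
  have apart: "\<forall>\<^sub>F a in nhds G. \<psi> r a \<noteq> \<psi> r' a" if "r \<in> ?R" "r' \<in> ?R" "r \<noteq> r'" for r r'
  proof -
    have "((\<lambda>a. \<psi> r a - \<psi> r' a) \<longlongrightarrow> r - r') (nhds G)" by (intro tendsto_diff lim that)
    then have "\<forall>\<^sub>F a in nhds G. \<psi> r a - \<psi> r' a \<noteq> 0"
      by (rule tendsto_imp_eventually_ne) (use that in simp)
    then show ?thesis by simp
  qed
  have "\<forall>\<^sub>F a in nhds G. \<forall>r\<in>?R. a \<in> V r"
    by (rule eventually_ball_finite[OF fin]) (rule ballI near)+
  moreover have "\<forall>\<^sub>F a in nhds G. \<forall>r\<in>?R. \<forall>r'\<in>?R - {r}. \<psi> r a \<noteq> \<psi> r' a"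
    by (intro eventually_ball_finite fin finite_Diff ballI apart) auto
  ultimately have "\<forall>\<^sub>F a in nhds G. (\<forall>r\<in>?R. a \<in> V r) \<and> (\<forall>r\<in>?R. \<forall>r'\<in>?R - {r}. \<psi> r a \<noteq> \<psi> r' a)"
    by (rule eventually_conj)
  then obtain U where U: "open U" "G \<in> U" "\<And>a r. a \<in> U \<Longrightarrow> r \<in> ?R \<Longrightarrow> a \<in> V r"
    and ne: "\<And>a r r'. a \<in> U \<Longrightarrow> r \<in> ?R \<Longrightarrow> r' \<in> ?R - {r} \<Longrightarrow> \<psi> r a \<noteq> \<psi> r' a"
    unfolding eventually_nhds by metis
  have inj: "inj_on (\<lambda>r. \<psi> r a) ?R" if "a \<in> U" for a
  proof (rule inj_onI, rule ccontr)
    fix r r' assume "r \<in> ?R" "r' \<in> ?R" "\<psi> r a = \<psi> r' a" "r \<noteq> r'"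
    then show False using ne[OF that, of r r'] by simp
  qed
  have roots: "strictly_hyperbolic (P e a) \<and> {x. poly (P e a) x = 0} = (\<lambda>r. \<psi> r a) ` ?R"
    if a: "a \<in> U" for a
  proof -
    let ?A = "(\<lambda>r. \<psi> r a) ` ?R"
    have cardA: "card ?A = CARD('n)" using card_image[OF inj[OF a]] card by simp
    have root: "poly (P e a) x = 0" if "x \<in> ?A" for x using \<psi>(2) U(3)[OF a] that by blast
    have a0: "P e a \<noteq> 0" using lead_coeff_P[of e a] by auto
    have sh: "strictly_hyperbolic (P e a)"
      using root cardA by (intro strictly_hyperbolic_if_enough_roots[OF a0, of ?A]) (auto simp: degree_P)
    then have "card {x. poly (P e a) x = 0} = card ?A"
      using cardA by (simp add: strictly_hyperbolic_def degree_P)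
    moreover have "?A \<subseteq> {x. poly (P e a) x = 0}" using root by blast
    ultimately have "?A = {x. poly (P e a) x = 0}"
      by (intro card_subset_eq card_roots_le_degree(2)[OF a0]) simp_all
    then show ?thesis using sh by simp
  qed
  show ?thesis
  proof (rule that[of U \<psi>])
    show "\<And>r. poly (P e G) r = 0 \<Longrightarrow> \<psi> r G = r" using \<psi>(1) by simp
    show "\<And>r a. poly (P e G) r = 0 \<Longrightarrow> a \<in> U \<Longrightarrow> (\<psi> r has_derivative
      (\<lambda>v. - poly (increment e v) (\<psi> r a) / poly (pderiv (P e a)) (\<psi> r a))) (at a)"
      using \<psi>(3) U(3) by simp
    show "open U" "G \<in> U" using U(1,2) .
    show "strictly_hyperbolic (P e a)"
      "{x. poly (P e a) x = 0} = (\<lambda>r. \<psi> r a) ` ?R" if "a \<in> U" for a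
      using roots[OF that] by blast+
  qed
qed

theorem proposition10:
  fixes e :: "nat \<Rightarrow> 'n::finite" and n k s :: nat and G :: "real ^ 'n"
  assumes "bij_betw e {1..n} (UNIV :: 'n set)"
    and "2 \<le> k" and "k \<le> n - 1"
    and "G \<in> interior (hyperbolicity_domain e)"
    and "card (root_equalities e k G) = s"
    and "card (fst ` root_equalities e k G) = s"
    and "card (snd ` root_equalities e k G) = s"
  shows "\<exists>U H. open U \<and> G \<in> U \<and>
           (\<forall>l\<in>{1..s}. smooth_hypersurface (H l)) \<and>
           discriminant_set e 0 k \<inter> U = (\<Union>l\<in>{1..s}. H l) \<and>
           intersect_transversally {1..s} H G"
proof -
  have n: "n = CARD('n)" using bij_betw_same_card[OF assms(1)] by simp
  then have e: "bij_betw e {1..CARD('n)} UNIV" using assms(1) by simp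
  have k: "1 \<le> k" "k < CARD('n)" and three: "3 \<le> CARD('n)" using assms(2,3) n by auto
  have hyp: "strictly_hyperbolic (P e G)"
    using interior_hyperbolicity_domain_strictly_hyperbolic[OF e three assms(4)] .
  obtain U0 \<psi> where U0: "open U0" "G \<in> U0"
    and \<psi>G: "\<And>r. poly (P e G) r = 0 \<Longrightarrow> \<psi> r G = r"
    and hypU: "\<And>a. a \<in> U0 \<Longrightarrow> strictly_hyperbolic (P e a)"
    and roots: "\<And>a. a \<in> U0 \<Longrightarrow> {x. poly (P e a) x = 0} = (\<lambda>r. \<psi> r a) ` {r. poly (P e G) r = 0}"
    and \<psi>': "\<And>r a. poly (P e G) r = 0 \<Longrightarrow> a \<in> U0 \<Longrightarrow> (\<psi> r has_derivative
      (\<lambda>v. - poly (increment e v) (\<psi> r a) / poly (pderiv (P e a)) (\<psi> r a))) (at a)"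
    by (rule roots_follow_coefficients[OF hyp]) blast
  let ?R = "{r. poly (P e G) r = 0}"
  have finR: "finite ?R"
    using hyp by (intro card_roots_le_degree(2)) (simp add: strictly_hyperbolic_def)
  have simple: "poly (pderiv (P e a)) (\<psi> r a) \<noteq> 0" if "r \<in> ?R" "a \<in> U0" for r a
    using strictly_hyperbolic_simple_root[OF hypU[OF that(2)]] roots[OF that(2)] that(1) by blast
  define F where "F r a = poly (dP e k a) (\<psi> r a)" for r a
  have F': "(F r has_derivative contact_differential e k a (\<psi> r a)) (at a)"
    if "r \<in> ?R" "a \<in> U0" for r a
  proof -
    have "poly (P e G) r = 0" using that by simp
    from poly_dP_has_derivative[OF has_derivative_ident \<psi>'[OF this that(2)], of e k]
    show ?thesis
      unfolding F_def[abs_def]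
      by (rule has_derivative_eq_rhs) (simp add: contact_differential_def fun_eq_iff)
  qed
  have F_smooth: "smooth_on V (F r)" if "r \<in> ?R" "open V" "V \<subseteq> U0" for r V
    unfolding F_def[abs_def]
    using root_function_smooth[OF that(2), of e "\<psi> r" k] simple \<psi>' that by blast
  define C where "C = {r \<in> ?R. F r G = 0}"
  have CR: "C \<subseteq> ?R" and finC: "finite C" using finR by (auto simp: C_def)
  have C_eq: "C = {x. poly (P e G) x = 0 \<and> poly (dP e k G) x = 0}"
    using \<psi>G by (auto simp: C_def F_def)
  have "card C = s" using C_eq card_root_equalities[OF hyp, of k] k assms(5) by simp
  then obtain c where c: "bij_betw c {1..s} C" using ex_bij_betw_nat_finite_1[OF finC] by blast
  \<comment> \<open>roots of \<open>P e G\<close> that are not common do not meet the discriminant set close to \<open>G\<close>\<close>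
  have "\<forall>\<^sub>F a in nhds G. F r a \<noteq> 0" if "r \<in> ?R - C" for r
  proof -
    have "isCont (F r) G" using has_derivative_continuous[OF F'[of r G]] that U0 by simp
    then have "(F r \<longlongrightarrow> F r G) (nhds G)"
      using tendsto_at_iff_tendsto_nhds[of "F r" G] by (simp add: isCont_def)
    then show ?thesis by (rule tendsto_imp_eventually_ne) (use that in \<open>simp add: C_def\<close>)
  qed
  then have "\<forall>\<^sub>F a in nhds G. \<forall>r\<in>?R - C. F r a \<noteq> 0"
    using finR by (intro eventually_ball_finite) auto
  then have "\<forall>\<^sub>F a in nhds G. a \<in> U0 \<and> (\<forall>r\<in>?R - C. F r a \<noteq> 0)"
    using U0 by (intro eventually_conj eventually_nhds_in_open)
  then obtain U where U: "open U" "G \<in> U" "U \<subseteq> U0" "\<And>r a. r \<in> ?R - C \<Longrightarrow> a \<in> U \<Longrightarrow> F r a \<noteq> 0"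
    unfolding eventually_nhds by blast
  define H where "H l = {a \<in> U. F (c l) a = 0}" for l
  have cC: "c l \<in> C" if "l \<in> {1..s}" for l using c that by (auto simp: bij_betw_def)
  define \<nu> where "\<nu> r a = (SOME \<nu>. GDERIV (F r) a :> \<nu>
      \<and> (\<forall>v. v \<bullet> \<nu> = contact_differential e k a (\<psi> r a) v))" for r a
  have \<nu>: "GDERIV (F r) a :> \<nu> r a" "v \<bullet> \<nu> r a = contact_differential e k a (\<psi> r a) v"
    if "r \<in> ?R" "a \<in> U0" for r a v
    using someI_ex[OF gradient_of_derivative[OF F'[OF that]]] unfolding \<nu>_def by blast+
  have equation: "local_equation (H l) a (F (c l)) (\<nu> (c l) a)" if l: "l \<in> {1..s}" and a: "a \<in> H l" for l a
  proof -
    have aU: "a \<in> U0" and Fa: "F (c l) a = 0" using a U(3) by (auto simp: H_def)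
    have cl: "c l \<in> ?R" using cC[OF l] CR by blast
    have root: "poly (P e a) (\<psi> (c l) a) = 0" using roots[OF aU] cl by blast
    have "\<nu> (c l) a \<noteq> 0"
    proof
      assume "\<nu> (c l) a = 0"
      then have "contact_differential e k a (\<psi> (c l) a) v = 0" for v
        using \<nu>(2)[OF cl aU, of v] by simp
      \<comment> \<open>a single functional at a common root is an independent family\<close>
      then have "(1 :: real) = 0"
        using contact_differentials_independent[OF e hypU[OF aU] k,
            of "{\<psi> (c l) a}" "\<lambda>_. 1" "\<psi> (c l) a"] root Fa
        by (simp add: F_def)
      then show False by simp
    qed
    moreover have "smooth_on U (F (c l))" using F_smooth[OF cl U(1,3)] .
    ultimately show ?thesis
      unfolding local_equation_def using a \<nu>(1)[OF cl aU] U(1)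
      by (intro conjI exI[of _ U]) (auto simp: H_def)
  qed
  have GH: "G \<in> H l" if "l \<in> {1..s}" for l
    using cC[OF that] U(2) by (simp add: H_def C_def)
  have discr: "discriminant_set e 0 k \<inter> U = (\<Union>l\<in>{1..s}. H l)"
  proof -
    have "a \<in> discriminant_set e 0 k \<longleftrightarrow> (\<exists>l\<in>{1..s}. F (c l) a = 0)" if a: "a \<in> U" for a
    proof -
      have aU: "a \<in> U0" using a U(3) by blast
      have "a \<in> discriminant_set e 0 k \<longleftrightarrow> (\<exists>x. poly (P e a) x = 0 \<and> poly (dP e k a) x = 0)"
        using resultant_eq_0_iff_common_root[OF hypU[OF aU]]
        by (simp add: discriminant_set_def dP_def)
      also have "\<dots> \<longleftrightarrow> (\<exists>x\<in>{x. poly (P e a) x = 0}. poly (dP e k a) x = 0)" by blast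
      also have "\<dots> \<longleftrightarrow> (\<exists>r\<in>?R. F r a = 0)" unfolding roots[OF aU] F_def by blast
      also have "\<dots> \<longleftrightarrow> (\<exists>r\<in>C. F r a = 0)" using U(4) a CR by blast
      also have "\<dots> \<longleftrightarrow> (\<exists>l\<in>{1..s}. F (c l) a = 0)" using c by (auto simp: bij_betw_def)
      finally show ?thesis .
    qed
    then show ?thesis by (auto simp: H_def)
  qed
  have "inj_on (\<lambda>l. \<nu> (c l) G) {1..s} \<and> independent ((\<lambda>l. \<nu> (c l) G) ` {1..s})"
  proof -
    have "\<mu> i = 0" if sum: "(\<Sum>l\<in>{1..s}. \<mu> l *\<^sub>R \<nu> (c l) G) = 0" and i: "i \<in> {1..s}" for \<mu> i
    proof -
      define d where "d = inv_into {1..s} c"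
      have d: "d (c l) = l" if "l \<in> {1..s}" for l
        using bij_betw_inv_into_left[OF c that] by (simp add: d_def)
      have vanish: "(\<Sum>r\<in>C. \<mu> (d r) * contact_differential e k G r v) = 0" for v
      proof -
        have "(\<Sum>r\<in>C. \<mu> (d r) * contact_differential e k G r v)
            = (\<Sum>l\<in>{1..s}. \<mu> (d (c l)) * contact_differential e k G (c l) v)"
          by (rule sum.reindex_bij_betw[OF c, symmetric])
        also have "\<dots> = (\<Sum>l\<in>{1..s}. \<mu> l * (v \<bullet> \<nu> (c l) G))"
        proof (intro sum.cong refl)
          fix l assume l: "l \<in> {1..s}"
          then have "c l \<in> ?R" using cC CR by blast
          then show "\<mu> (d (c l)) * contact_differential e k G (c l) v = \<mu> l * (v \<bullet> \<nu> (c l) G)"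
            using \<nu>(2)[of "c l" G v] \<psi>G U0(2) d[OF l] by simp
        qed
        also have "\<dots> = v \<bullet> (\<Sum>l\<in>{1..s}. \<mu> l *\<^sub>R \<nu> (c l) G)" by (simp add: inner_sum_right)
        finally show ?thesis using sum by simp
      qed
      have "\<mu> (d (c i)) = 0"
        by (rule contact_differentials_independent[OF e hyp k equalityD1[OF C_eq] vanish cC[OF i]])
      then show ?thesis using d[OF i] by simp
    qed
    then show ?thesis using independent_family[of "{1..s}" "\<lambda>l. \<nu> (c l) G"] by blast
  qed
  then have "intersect_transversally {1..s} H G"
    unfolding intersect_transversally_def using equation GH
    by (intro exI[of _ "\<lambda>l. \<nu> (c l) G"]) blast
  moreover have "\<forall>l\<in>{1..s}. smooth_hypersurface (H l)"
    unfolding smooth_hypersurface_def using equation by blast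
  ultimately show ?thesis using U(1,2) discr by blast
qed

end
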